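(* Let $\mathscr{F}$ be a collection of pairs $(f,g)$ of non-negative measurable functions on $\mathbb{R}^n$. Let $1\le p_0\le\infty$, $0<r_0\le\infty$, and $0<q_0\le\infty$. Assume that for all $w\in A_{p_0,r_0}$ we have $$\|fw\|_{L^{q_0}}\le\varphi([w]_{A_{p_0,r_0}})\,\|gw\|_{L^{p_0}}$$ for all $(f,g)\in\mathscr{F}$, where $\varphi\ge0$ is a non-decreasing function. Then for all $1<p\le\infty$, $0<r<\infty$, and $0<q\le\infty$ such that $$\frac1q-\frac1{q_0}=\frac1r-\frac1{r_0}=\frac1p-\frac1{p_0},$$ there is a non-decreasing function $\widetilde\varphi\ge0$ such that for all $w\in A_{p,r}$ we have $$\|fw\|_{L^q}\le\widetilde\varphi([w]_{A_{p,r}})\,\|gw\|_{L^p}$$ for all $(f,g)\in\mathscr{F}$.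
   Context: All function spaces are over $\mathbb{R}^n$ with Lebesgue measure; $L^q$ with $0<q<1$ carries the usual quasi-norm. A weight is a measurable function $v$ with $0<v<\infty$ a.e. $Q$ denotes cubes in $\mathbb{R}^n$, and $p'$ is the conjugate exponent of $p$. For $1\le p\le\infty$ and $0<r\le\infty$, a weight $v$ belongs to $A_{p,r}$ if $$[v]_{A_{p,r}}=\sup_Q\Big(\frac1{|Q|}\int_Qv^r\,dx\Big)^{\frac1r}\Big(\frac1{|Q|}\int_Qv^{-p'}\,dx\Big)^{\frac1{p'}}<\infty,$$ where the first factor is replaced by $\operatorname{ess\,sup}_Qv$ when $r=\infty$ and the second factor by $\operatorname{ess\,sup}_Qv^{-1}$ when $p=1$ (and $p'=1$ when $p=\infty$). Conventions: $\frac1\infty=0$; $\varphi,\widetilde\varphi$ are finite-valued functions on $[0,\infty)$. *)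

theory Defs
  imports "HOL-Analysis.Analysis" "HOL-Probability.Essential_Supremum"
begin

(* Real powers on [0,\<infinity>], with the conventions 0^a = \<infinity> and \<infinity>^a = 0 for a < 0.
   For a = 0 the value is 1. *)
definition epowr :: "ennreal \<Rightarrow> real \<Rightarrow> ennreal" where
  "epowr x a =
     (if a = 0 then 1
      else if x = 0 then (if a < 0 then \<infinity> else 0)
      else if x = \<infinity> then (if a < 0 then 0 else \<infinity>)
      else ennreal (enn2real x powr a))"

(* Exponents range over ereal, so that \<infinity> is allowed, 1 / \<infinity> = 0, and differences
   of reciprocals are not truncated at 0. *)

definition Lnorm :: "ereal \<Rightarrow> ((real^'n) \<Rightarrow> ennreal) \<Rightarrow> ennreal" where
  "Lnorm q h =
     (if q = \<infinity> then esssup lebesgue h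
      else epowr (\<integral>\<^sup>+ x. epowr (h x) (real_of_ereal q) \<partial>lebesgue) (1 / real_of_ereal q))"

definition conj_exponent :: "ereal \<Rightarrow> ereal" where
  "conj_exponent p = (if p = 1 then \<infinity> else if p = \<infinity> then 1 else p / (p - 1))"

definition cubes :: "(real^'n) set set" where
  "cubes = {cbox a (\<chi> i. a $ i + l) | a l. l > 0}"

definition average :: "(real^'n) set \<Rightarrow> ((real^'n) \<Rightarrow> ennreal) \<Rightarrow> ennreal" where
  "average Q h = (\<integral>\<^sup>+ x\<in>Q. h x \<partial>lebesgue) / emeasure lebesgue Q"

definition weight :: "((real^'n) \<Rightarrow> ennreal) \<Rightarrow> bool" where
  "weight v \<longleftrightarrow> v \<in> borel_measurable lebesgue \<and> (AE x in lebesgue. 0 < v x \<and> v x < \<infinity>)"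

definition A_const :: "ereal \<Rightarrow> ereal \<Rightarrow> ((real^'n) \<Rightarrow> ennreal) \<Rightarrow> ennreal" where
  "A_const p r v =
     (SUP Q\<in>cubes.
        (if r = \<infinity> then esssup (lebesgue_on Q) v
         else epowr (average Q (\<lambda>x. epowr (v x) (real_of_ereal r))) (1 / real_of_ereal r)) *
        (if p = 1 then esssup (lebesgue_on Q) (\<lambda>x. inverse (v x))
         else epowr (average Q (\<lambda>x. epowr (v x) (- real_of_ereal (conj_exponent p))))
                (1 / real_of_ereal (conj_exponent p))))"

definition A_class :: "ereal \<Rightarrow> ereal \<Rightarrow> ((real^'n) \<Rightarrow> ennreal) set" where
  "A_class p r = {v. weight v \<and> A_const p r v < \<infinity>}"

end

theory Submission
  imports Defs
begin

text \<open>
  Put \<open>\<alpha> = 1/r\<close> and \<open>\<beta> = 1/p'\<close>. The constant of \<open>w\<close> is unchanged when \<open>w\<close> is replaced by \<open>1/w\<close> and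
  \<open>\<alpha>\<close>, \<open>\<beta>\<close> are exchanged, \<open>\<alpha> + \<beta>\<close> takes the same value at the given and at the wanted
  exponents, and \<open>V = w\<^sup>1\<^sup>/\<^sup>\<alpha>\<close> is a Muckenhoupt weight of exponent \<open>t = 1 + \<beta>/\<alpha> > 1\<close>.
  Let \<open>\<alpha> = \<alpha>0 + d\<close> with \<open>d > 0\<close>. For \<open>H \<ge> 0\<close> with integral at most 1, the Rubio de Francia
  algorithm in \<open>L\<^sup>t(V)\<close> gives an \<open>A\<^sub>1\<close> majorant \<open>\<rho>\<close> of \<open>(H/V)\<^sup>1\<^sup>/\<^sup>t\<close>; then \<open>h = \<rho>\<^sup>t V \<ge> H\<close> has bounded
  integral, and \<open>w h\<^sup>-\<^sup>d\<close> has a constant at the exponents \<open>\<alpha>0\<close>, \<open>\<beta> + d\<close> controlled by that of \<open>w\<close>.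
  If \<open>p < p0\<close>, take \<open>H\<close> to be the normalised \<open>(g w)\<^sup>p\<close>, apply the hypothesis to \<open>w h\<^sup>-\<^sup>d\<close>, and
  use the Hoelder inequality for \<open>f w\<close>. If \<open>p > p0\<close>, apply the construction to \<open>1/w\<close> for every
  \<open>H\<close>, apply the hypothesis to \<open>w h\<^sup>d\<close>, and recover the norm of \<open>f w\<close> by duality.
\<close>

section \<open>Powers on the extended half-line and the Hoelder inequality\<close>

lemma ennreal_pos_cases [case_names zero pos top]:
  fixes x :: ennreal
  obtains "x = 0" | r where "0 < r" "x = ennreal r" | "x = top"
proof (cases x rule: ennreal_cases)
  case (real r)
  then show ?thesis using that(1) that(2)[of r] by (cases "r = 0") auto
qed (use that in auto)

lemma epowr_0_right [simp]: "epowr x 0 = 1"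
  by (simp add: epowr_def)

lemma epowr_0_left: "epowr 0 a = (if a = 0 then 1 else if a < 0 then top else 0)"
  by (simp add: epowr_def)

lemma epowr_top_left: "epowr top a = (if a = 0 then 1 else if a < 0 then 0 else top)"
  by (simp add: epowr_def)

lemma epowr_ennreal: "0 < r \<Longrightarrow> epowr (ennreal r) a = ennreal (r powr a)"
  by (simp add: epowr_def)

lemmas epowr_simps = epowr_0_left epowr_top_left epowr_ennreal

lemma epowr_1_left [simp]: "epowr 1 a = 1"
  using epowr_ennreal[of 1 a] by simp

lemma epowr_1_right [simp]: "epowr x 1 = x"
  by (cases x rule: ennreal_pos_cases) (auto simp: epowr_simps)

lemma epowr_mono: "0 \<le> a \<Longrightarrow> x \<le> y \<Longrightarrow> epowr x a \<le> epowr y a"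
  by (cases x rule: ennreal_pos_cases; cases y rule: ennreal_pos_cases)
     (auto simp: epowr_simps top_unique intro!: ennreal_leI powr_mono2)

lemma epowr_less_top_iff: "epowr x a < top \<longleftrightarrow> a = 0 \<or> (0 < a \<and> x < top) \<or> (a < 0 \<and> 0 < x)"
  by (cases x rule: ennreal_pos_cases) (auto simp: epowr_simps)

lemma epowr_pos_iff: "0 < epowr x a \<longleftrightarrow> a = 0 \<or> (0 < a \<and> 0 < x) \<or> (a < 0 \<and> x < top)"
  by (cases x rule: ennreal_pos_cases) (auto simp: epowr_simps)

lemma epowr_epowr: "epowr (epowr x a) b = epowr x (a * b)"
  by (cases x rule: ennreal_pos_cases)
     (auto simp: epowr_simps powr_powr mult_less_0_iff zero_less_mult_iff)

lemma epowr_mult: "0 \<le> a \<Longrightarrow> epowr (x * y) a = epowr x a * epowr y a"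
  by (cases x rule: ennreal_pos_cases; cases y rule: ennreal_pos_cases)
     (auto simp: epowr_simps powr_mult ennreal_mult_top ennreal_top_mult simp flip: ennreal_mult)

lemma epowr_inverse: "epowr (inverse x) a = epowr x (- a)"
  by (cases x rule: ennreal_pos_cases)
     (auto simp: epowr_simps inverse_ennreal powr_minus inverse_powr)

lemma inverse_epowr: "inverse (epowr x a) = epowr x (- a)"
  by (cases x rule: ennreal_pos_cases)
     (auto simp: epowr_simps inverse_ennreal powr_minus inverse_powr)

lemma epowr_antimono: "a \<le> 0 \<Longrightarrow> x \<le> y \<Longrightarrow> epowr y a \<le> epowr x a"
  by (cases x rule: ennreal_pos_cases; cases y rule: ennreal_pos_cases)
     (auto simp: epowr_simps top_unique intro!: ennreal_leI powr_mono2')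

lemma epowr_divide: "0 \<le> a \<Longrightarrow> epowr (x / y) a = epowr x a / epowr y a"
  by (simp add: divide_ennreal_def epowr_mult epowr_inverse inverse_epowr)

lemma epowr_add: "0 < x \<Longrightarrow> x < top \<Longrightarrow> epowr x (a + b) = epowr x a * epowr x b"
  by (cases x rule: ennreal_pos_cases) (auto simp: epowr_simps powr_add simp flip: ennreal_mult)

lemma epowr_add_nonneg: "0 \<le> a \<Longrightarrow> 0 \<le> b \<Longrightarrow> epowr x (a + b) = epowr x a * epowr x b"
  by (cases x rule: ennreal_pos_cases) (auto simp: epowr_simps powr_add simp flip: ennreal_mult)

lemma epowr_mult_finite:
  "0 < x \<Longrightarrow> x < top \<Longrightarrow> 0 < y \<Longrightarrow> y < top \<Longrightarrow> epowr (x * y) a = epowr x a * epowr y a"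
  by (cases x rule: ennreal_pos_cases; cases y rule: ennreal_pos_cases)
     (auto simp: epowr_simps powr_mult simp flip: ennreal_mult)

lemma epowr_le_iff: "0 < a \<Longrightarrow> epowr x a \<le> y \<longleftrightarrow> x \<le> epowr y (1 / a)"
  using epowr_mono[of "1 / a" "epowr x a" y] epowr_mono[of a x "epowr y (1 / a)"]
  by (auto simp: epowr_epowr)

lemma measurable_epowr_borel: "(\<lambda>x. epowr x a) \<in> borel_measurable borel"
  unfolding epowr_def by measurable

lemma measurable_epowr [measurable (raw)]:
  "f \<in> borel_measurable M \<Longrightarrow> (\<lambda>x. epowr (f x) a) \<in> borel_measurable M"
  using measurable_compose[OF _ measurable_epowr_borel] .

lemma epowr_Young:
  assumes "0 \<le> \<theta>" "\<theta> \<le> 1"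
  shows "epowr a \<theta> * epowr b (1 - \<theta>) \<le> ennreal \<theta> * a + ennreal (1 - \<theta>) * b"
proof (cases "\<theta> = 0 \<or> \<theta> = 1")
  case False
  then have "0 < \<theta>" "\<theta> < 1" using assms by auto
  then show ?thesis
    using Youngs_inequality_0[of \<theta> "1 - \<theta>"]
    by (cases a rule: ennreal_pos_cases; cases b rule: ennreal_pos_cases)
       (auto simp: epowr_simps ennreal_mult_top simp flip: ennreal_mult ennreal_plus intro!: ennreal_leI)
qed auto

lemma nn_integral_Holder:
  assumes [measurable]: "f \<in> borel_measurable M" "g \<in> borel_measurable M"
    and \<theta>: "0 \<le> \<theta>" "\<theta> \<le> 1"
  shows "(\<integral>\<^sup>+x. epowr (f x) \<theta> * epowr (g x) (1 - \<theta>) \<partial>M)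
           \<le> epowr (\<integral>\<^sup>+x. f x \<partial>M) \<theta> * epowr (\<integral>\<^sup>+x. g x \<partial>M) (1 - \<theta>)"
proof -
  define F G where "F = (\<integral>\<^sup>+x. f x \<partial>M)" and "G = (\<integral>\<^sup>+x. g x \<partial>M)"
  consider "\<theta> = 0" | "\<theta> = 1" | "0 < \<theta>" "\<theta> < 1" using \<theta> by linarith
  then show ?thesis
  proof cases
    case 3
    consider "F = 0 \<or> G = 0" | "F \<noteq> 0" "G \<noteq> 0" "F = top \<or> G = top"
      | "0 < F" "F < top" "0 < G" "G < top"
      by (metis not_gr_zero top.not_eq_extremum)
    then show ?thesis
    proof cases
      case 1
      then have "(AE x in M. f x = 0) \<or> (AE x in M. g x = 0)"
        unfolding F_def G_def by (auto simp: nn_integral_0_iff_AE)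
      then have "AE x in M. epowr (f x) \<theta> * epowr (g x) (1 - \<theta>) = 0"
        using 3 by (auto simp: epowr_0_left elim: eventually_mono)
      then have "(\<integral>\<^sup>+x. epowr (f x) \<theta> * epowr (g x) (1 - \<theta>) \<partial>M) = 0"
        by (simp add: nn_integral_0_iff_AE)
      then show ?thesis by simp
    next
      case 2
      then have "epowr F \<theta> * epowr G (1 - \<theta>) = top"
        using 3 by (auto simp: ennreal_mult_eq_top_iff epowr_top_left zero_less_iff_neq_zero[symmetric] epowr_pos_iff)
      then show ?thesis by (simp add: F_def G_def)
    next
      case 4: 3
      have *: "epowr (f x) \<theta> * epowr (g x) (1 - \<theta>) =
          epowr F \<theta> * epowr G (1 - \<theta>) * (epowr (f x / F) \<theta> * epowr (g x / G) (1 - \<theta>))" for x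
      proof -
        have "epowr F \<theta> * epowr G (1 - \<theta>) * (epowr (f x / F) \<theta> * epowr (g x / G) (1 - \<theta>))
           = epowr (F * (f x / F)) \<theta> * epowr (G * (g x / G)) (1 - \<theta>)"
          using 3 by (simp add: epowr_mult mult_ac)
        also have "\<dots> = epowr (f x) \<theta> * epowr (g x) (1 - \<theta>)"
          using 4 by (simp add: ennreal_times_divide mult.commute[of _ "f x"] mult.commute[of _ "g x"]
              ennreal_mult_divide_eq)
        finally show ?thesis by simp
      qed
      have "(\<integral>\<^sup>+x. epowr (f x) \<theta> * epowr (g x) (1 - \<theta>) \<partial>M)
          = epowr F \<theta> * epowr G (1 - \<theta>) * (\<integral>\<^sup>+x. epowr (f x / F) \<theta> * epowr (g x / G) (1 - \<theta>) \<partial>M)"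
        by (subst *) (simp add: nn_integral_cmult)
      also have "\<dots> \<le> epowr F \<theta> * epowr G (1 - \<theta>) *
           (\<integral>\<^sup>+x. ennreal \<theta> * (f x / F) + ennreal (1 - \<theta>) * (g x / G) \<partial>M)"
        using \<theta> by (intro mult_left_mono nn_integral_mono epowr_Young) auto
      also have "(\<integral>\<^sup>+x. ennreal \<theta> * (f x / F) + ennreal (1 - \<theta>) * (g x / G) \<partial>M)
          = ennreal \<theta> * (F / F) + ennreal (1 - \<theta>) * (G / G)"
        by (simp add: nn_integral_add nn_integral_cmult nn_integral_divide F_def G_def)
      also have "\<dots> = 1"
        using 4 3 by (simp flip: ennreal_plus)
      finally show ?thesis by (simp add: F_def G_def)
    qed
  qed auto
qed

section \<open>Maximal functions of doubling measures\<close>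

definition cube :: "real^'n \<Rightarrow> real \<Rightarrow> (real^'n) set" where
  "cube a l = cbox a (\<chi> i. a $ i + l)"

lemma mem_cube: "x \<in> cube a l \<longleftrightarrow> (\<forall>i. a $ i \<le> x $ i \<and> x $ i \<le> a $ i + l)"
  by (simp add: cube_def mem_box_cart)

lemma cubes_eq: "cubes = {cube a l | a l. 0 < l}"
  by (simp add: cubes_def cube_def)

lemma cube_lebesgue [measurable]: "cube a l \<in> sets lebesgue"
  by (simp add: cube_def)

lemma cubes_lebesgue: "Q \<in> cubes \<Longrightarrow> Q \<in> sets lebesgue"
  by (auto simp: cubes_eq)

lemma emeasure_cube: "0 \<le> l \<Longrightarrow> emeasure lebesgue (cube a l :: (real^'n) set) = ennreal (l ^ CARD('n))"
proof -
  assume l: "0 \<le> l"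
  then have "cbox a (\<chi> i. a $ i + l) \<noteq> {}"
    by (auto simp: mem_box_cart set_eq_iff intro!: exI[of _ a])
  then have "measure lebesgue (cube a l) = l ^ CARD('n)"
    using l by (simp add: cube_def content_cbox_cart)
  moreover have "emeasure lebesgue (cube a l) = ennreal (measure lebesgue (cube a l))"
    by (simp add: cube_def emeasure_lborel_cbox_eq emeasure_eq_ennreal_measure)
  ultimately show ?thesis by simp
qed

lemma cubes_emeasure:
  assumes "Q \<in> cubes" shows "0 < emeasure lebesgue Q" "emeasure lebesgue Q < top"
proof -
  obtain a l where Q: "Q = cube a l" "0 < l" using assms by (auto simp: cubes_eq)
  show "0 < emeasure lebesgue Q" "emeasure lebesgue Q < top"
    unfolding Q(1) emeasure_cube[OF less_imp_le[OF Q(2)]] using Q(2) by auto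
qed

definition rational_cubes :: "(real^'n) set set" where
  "rational_cubes = (\<lambda>(a :: rat^'n, l). cube (\<chi> i. of_rat (a $ i)) (of_rat l)) ` (UNIV \<times> {0<..})"

lemma countable_rational_cubes: "countable rational_cubes"
  by (auto simp: rational_cubes_def)

lemma rational_cubes_subset: "rational_cubes \<subseteq> cubes"
proof
  fix Q :: "(real^'n) set" assume "Q \<in> rational_cubes"
  then obtain a :: "rat^'n" and l where "Q = cube (\<chi> i. of_rat (a $ i)) (of_rat l)" "0 < l"
    by (auto simp: rational_cubes_def)
  then show "Q \<in> cubes" by (auto simp: cubes_eq intro!: exI)
qed

lemma rational_cube_superset:
  assumes "Q \<in> (cubes :: (real^'n) set set)"
  obtains R where "R \<in> rational_cubes" "Q \<subseteq> R"
    "emeasure lebesgue R \<le> ennreal (3 ^ CARD('n)) * emeasure lebesgue Q"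
proof -
  obtain a :: "real^'n" and l where Q: "Q = cube a l" "0 < l"
    using assms by (auto simp: cubes_eq)
  have "\<exists>q. a $ i - l < of_rat q \<and> of_rat q < a $ i" for i
    using of_rat_dense[of "a $ i - l" "a $ i"] Q by auto
  then obtain b where b: "\<And>i. a $ i - l < of_rat (b i) \<and> of_rat (b i) < a $ i" by metis
  obtain m where m: "2 * l < of_rat m" "of_rat m < 3 * l"
    using of_rat_dense[of "2 * l" "3 * l"] Q by auto
  have m0: "0 < m"
    using m Q by (metis zero_less_of_rat_iff less_trans mult_pos_pos zero_less_numeral)
  show ?thesis
  proof (rule that[of "cube (\<chi> i. of_rat (vec_lambda b $ i)) (of_rat m)"])
    show "cube (\<chi> i. of_rat (vec_lambda b $ i)) (of_rat m) \<in> rational_cubes"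
      unfolding rational_cubes_def using m0 by (intro image_eqI[of _ _ "(vec_lambda b, m)"]) auto
    show "Q \<subseteq> cube (\<chi> i. of_rat (vec_lambda b $ i)) (of_rat m)"
    proof
      fix x assume "x \<in> Q"
      show "x \<in> cube (\<chi> i. of_rat (vec_lambda b $ i)) (of_rat m)"
        unfolding mem_cube
      proof
        fix i
        have "a $ i \<le> x $ i" "x $ i \<le> a $ i + l" using \<open>x \<in> Q\<close> by (auto simp: Q mem_cube)
        then show "(\<chi> i. of_rat (vec_lambda b $ i)) $ i \<le> x $ i \<and>
           x $ i \<le> (\<chi> i. of_rat (vec_lambda b $ i)) $ i + of_rat m"
          using b[of i] m by auto
      qed
    qed
    have "(of_rat m) ^ CARD('n) \<le> (3 * l) ^ CARD('n)"
      using m m0 by (intro power_mono) auto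
    then show "emeasure lebesgue (cube (\<chi> i. of_rat (vec_lambda b $ i)) (of_rat m) :: (real^'n) set)
        \<le> ennreal (3 ^ CARD('n)) * emeasure lebesgue Q"
      unfolding Q(1) using m0 Q(2)
      by (subst (1 2) emeasure_cube) (auto simp: power_mult_distrib ennreal_leI simp flip: ennreal_mult)
  qed
qed

lemma Vitali_finite_cubes:
  fixes P :: "((real^'n) \<times> real) set"
  assumes "finite P" "\<And>a l. (a, l) \<in> P \<Longrightarrow> 0 < l"
  obtains G where "G \<subseteq> P" "disjoint_family_on (\<lambda>(a, l). cube a l) G"
    "(\<Union>(a, l)\<in>P. cube a l) \<subseteq> (\<Union>(a, l)\<in>G. cube (\<chi> i. a $ i - l) (3 * l))"
proof -
  have "\<exists>G. G \<subseteq> P \<and> disjoint_family_on (\<lambda>(a, l). cube a l) G \<and>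
      (\<Union>(a, l)\<in>P. cube a l) \<subseteq> (\<Union>(a, l)\<in>G. cube (\<chi> i. a $ i - l) (3 * l))"
    using assms
  proof (induction rule: finite_psubset_induct)
    case (psubset P)
    show ?case
    proof (cases "P = {}")
      case True
      then show ?thesis by (auto simp: disjoint_family_on_def)
    next
      case False
      define L where "L = Max (snd ` P)"
      have "L \<in> snd ` P" unfolding L_def using False psubset.hyps by (intro Max_in) auto
      then obtain a where a: "(a, L) \<in> P" by auto
      have L: "m \<le> L" if "(b, m) \<in> P" for b m
        unfolding L_def using that psubset.hyps by (intro Max_ge) (auto intro!: image_eqI[of _ snd "(b, m)"])
      have "0 < L" using a psubset.prems by auto
      have a_mem: "a \<in> cube a L" using \<open>0 < L\<close> by (simp add: mem_cube)
      define P' where "P' = {(b, m)\<in>P. cube b m \<inter> cube a L = {}}"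
      have "P' \<subset> P" using a a_mem by (auto simp: P'_def)
      have "\<exists>G. G \<subseteq> P' \<and> disjoint_family_on (\<lambda>(a, l). cube a l) G \<and>
          (\<Union>(a, l)\<in>P'. cube a l) \<subseteq> (\<Union>(a, l)\<in>G. cube (\<chi> i. a $ i - l) (3 * l))"
        by (rule psubset.IH[OF \<open>P' \<subset> P\<close>]) (use psubset.prems in \<open>auto simp: P'_def\<close>)
      then obtain G where G: "G \<subseteq> P'" "disjoint_family_on (\<lambda>(a, l). cube a l) G"
          "(\<Union>(a, l)\<in>P'. cube a l) \<subseteq> (\<Union>(a, l)\<in>G. cube (\<chi> i. a $ i - l) (3 * l))"
        by (elim exE conjE)
      have sub: "cube b m \<subseteq> cube (\<chi> i. a $ i - L) (3 * L)"
        if bm: "(b, m) \<in> P" "cube b m \<inter> cube a L \<noteq> {}" for b m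
      proof
        fix x assume x: "x \<in> cube b m"
        obtain y where y: "y \<in> cube b m" "y \<in> cube a L" using bm(2) by auto
        show "x \<in> cube (\<chi> i. a $ i - L) (3 * L)"
          unfolding mem_cube
        proof
          fix i
          have "b $ i \<le> x $ i" "x $ i \<le> b $ i + m" "b $ i \<le> y $ i" "y $ i \<le> b $ i + m"
            "a $ i \<le> y $ i" "y $ i \<le> a $ i + L"
            using x y by (auto simp: mem_cube)
          then show "(\<chi> i. a $ i - L) $ i \<le> x $ i \<and> x $ i \<le> (\<chi> i. a $ i - L) $ i + 3 * L"
            using L[OF bm(1)] by auto
        qed
      qed
      show ?thesis
      proof (intro exI conjI)
        show "insert (a, L) G \<subseteq> P" using G a by (auto simp: P'_def)
        show "disjoint_family_on (\<lambda>(a, l). cube a l) (insert (a, L) G)"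
        proof -
          have "cube b m \<inter> cube a L = {}" if "(b, m) \<in> G" for b m
            using G(1) that by (auto simp: P'_def)
          then show ?thesis
            using G(2) unfolding disjoint_family_on_def by (auto simp: Int_commute)
        qed
        show "(\<Union>(a, l)\<in>P. cube a l) \<subseteq> (\<Union>(a, l)\<in>insert (a, L) G. cube (\<chi> i. a $ i - l) (3 * l))"
        proof (safe)
          fix x b m assume bm: "(b, m) \<in> P" "x \<in> cube b m"
          show "x \<in> (\<Union>(a, l)\<in>insert (a, L) G. cube (\<chi> i. a $ i - l) (3 * l))"
          proof (cases "cube b m \<inter> cube a L = {}")
            case True
            then have "x \<in> (\<Union>(a, l)\<in>P'. cube a l)" using bm by (auto simp: P'_def)
            then show ?thesis using G(3) by auto
          next
            case False
            then show ?thesis using sub[OF bm(1)] bm(2) by auto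
          qed
        qed
      qed
    qed
  qed
  then show ?thesis using that by blast
qed

text \<open>
  The supremum runs over countably many cubes, which makes measurability immediate. By
  \<open>rational_cube_superset\<close> this costs only a factor \<open>3\<^sup>n\<close> against all cubes.
\<close>

definition maximal :: "(real^'n) measure \<Rightarrow> (real^'n \<Rightarrow> ennreal) \<Rightarrow> real^'n \<Rightarrow> ennreal" where
  "maximal \<mu> u x = (SUP Q\<in>rational_cubes. indicator Q x * ((\<integral>\<^sup>+y\<in>Q. u y \<partial>\<mu>) / emeasure \<mu> Q))"

lemma maximal_upper:
  "Q \<in> rational_cubes \<Longrightarrow> x \<in> Q \<Longrightarrow> (\<integral>\<^sup>+y\<in>Q. u y \<partial>\<mu>) / emeasure \<mu> Q \<le> maximal \<mu> u x"
  unfolding maximal_def by (rule SUP_upper2) auto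

lemma maximal_least:
  "(\<And>Q. Q \<in> rational_cubes \<Longrightarrow> x \<in> Q \<Longrightarrow> (\<integral>\<^sup>+y\<in>Q. u y \<partial>\<mu>) / emeasure \<mu> Q \<le> c) \<Longrightarrow> maximal \<mu> u x \<le> c"
  unfolding maximal_def by (rule SUP_least) (auto simp: indicator_def)

lemma measurable_maximal:
  fixes \<mu> :: "(real^'n) measure"
  assumes "sets \<mu> = sets lebesgue" shows "maximal \<mu> u \<in> borel_measurable \<mu>"
proof -
  have "(\<lambda>x. indicator Q x * ((\<integral>\<^sup>+y\<in>Q. u y \<partial>\<mu>) / emeasure \<mu> Q)) \<in> borel_measurable \<mu>"
    if "Q \<in> rational_cubes" for Q :: "(real^'n) set"
  proof -
    have [measurable]: "Q \<in> sets \<mu>"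
      using that rational_cubes_subset cubes_lebesgue assms by auto
    show ?thesis by measurable
  qed
  then show ?thesis
    unfolding maximal_def by (intro borel_measurable_SUP countable_rational_cubes)
qed

lemma ennreal_eq_topI:
  fixes x :: ennreal
  assumes "\<And>r::real. 0 < r \<Longrightarrow> ennreal r \<le> x"
  shows "x = top"
proof (rule ccontr)
  assume "x \<noteq> top"
  then obtain r where "0 \<le> r" "x = ennreal r" by (cases x) auto
  then show False using assms[of "r + 1"] by simp
qed

lemma nn_integral_powr_below:
  assumes "- 1 < a"
  shows "(\<integral>\<^sup>+t. (if 0 < t \<and> ennreal t < y then ennreal (t powr a) else 0) \<partial>lborel)
           = epowr y (a + 1) / ennreal (a + 1)"
proof -
  have fin: "(\<integral>\<^sup>+t. (if 0 < t \<and> ennreal t < ennreal r then ennreal (t powr a) else 0) \<partial>lborel)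
      = ennreal (r powr (a + 1) / (a + 1))" if "0 < r" for r
  proof -
    have "((\<lambda>t. if t \<in> {0..r} then t powr a else 0) has_integral (r powr (a + 1) / (a + 1))) UNIV"
      using has_integral_powr_from_0[OF assms, of r] that by (simp only: has_integral_restrict_UNIV less_imp_le)
    moreover have "(\<lambda>t. if t \<in> {0..r} then t powr a else 0) \<in> borel_measurable borel"
      by measurable
    ultimately have "(\<integral>\<^sup>+t. ennreal (if t \<in> {0..r} then t powr a else 0) \<partial>lborel)
        = ennreal (r powr (a + 1) / (a + 1))"
      by (intro nn_integral_has_integral_lborel) auto
    moreover have "AE t in lborel. t \<noteq> 0 \<and> t \<noteq> r"
      by (auto intro!: AE_conjI AE_lborel_singleton)
    then have "AE t in lborel. ennreal (if t \<in> {0..r} then t powr a else 0)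
        = (if 0 < t \<and> ennreal t < ennreal r then ennreal (t powr a) else 0)"
      by (rule eventually_mono) (use that in \<open>auto simp: ennreal_less_iff\<close>)
    then have "(\<integral>\<^sup>+t. ennreal (if t \<in> {0..r} then t powr a else 0) \<partial>lborel) =
        (\<integral>\<^sup>+t. (if 0 < t \<and> ennreal t < ennreal r then ennreal (t powr a) else 0) \<partial>lborel)"
      by (rule nn_integral_cong_AE)
    ultimately show ?thesis by simp
  qed
  show ?thesis
  proof (cases y rule: ennreal_pos_cases)
    case (pos r)
    then show ?thesis using fin assms by (simp add: epowr_ennreal divide_ennreal)
  next
    case top
    have "ennreal (r powr (a + 1) / (a + 1))
        \<le> (\<integral>\<^sup>+t. (if 0 < t \<and> ennreal t < y then ennreal (t powr a) else 0) \<partial>lborel)" if "0 < r" for r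
      unfolding fin[OF that, symmetric] top
      by (intro nn_integral_mono) (auto simp: top.not_eq_extremum)
    note large = this
    have "ennreal n \<le> (\<integral>\<^sup>+t. (if 0 < t \<and> ennreal t < y then ennreal (t powr a) else 0) \<partial>lborel)" if "0 < n" for n
      using large[of "(n * (a + 1)) powr (1 / (a + 1))"] that assms by (simp add: powr_powr abs_mult)
    then have "(\<integral>\<^sup>+t. (if 0 < t \<and> ennreal t < y then ennreal (t powr a) else 0) \<partial>lborel) = top"
      by (intro ennreal_eq_topI)
    then show ?thesis using assms top by (simp add: epowr_top_left ennreal_top_divide)
  qed (use assms in \<open>simp add: epowr_0_left\<close>)
qed

locale doubling_measure =
  fixes \<mu> :: "(real^'n) measure" and D :: real
  assumes sets_eq [measurable_cong]: "sets \<mu> = sets lebesgue"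
    and cube_pos: "0 < l \<Longrightarrow> 0 < emeasure \<mu> (cube a l)"
    and cube_finite: "0 < l \<Longrightarrow> emeasure \<mu> (cube a l) < top"
    and doubling: "0 < l \<Longrightarrow> emeasure \<mu> (cube (\<chi> i. a $ i - l) (3 * l)) \<le> ennreal D * emeasure \<mu> (cube a l)"
    and D_nonneg: "0 \<le> D"
begin

lemma cube_sets [measurable]: "cube a l \<in> sets \<mu>"
  by (simp add: sets_eq)

lemma space_eq [simp]: "space \<mu> = UNIV"
  using sets_eq_imp_space_eq[OF sets_eq] by simp

lemma UNIV_sets [simp]: "UNIV \<in> sets \<mu>"
  using sets.top[of \<mu>] by simp

lemma superlevel_maximal [measurable]: "{x. c < maximal \<mu> u x} \<in> sets \<mu>"
  using measurable_sets[OF measurable_maximal[OF sets_eq, of u], of "{c<..}"] by (simp add: vimage_def)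

sublocale sigma_finite_measure \<mu>
proof
  have "(\<Union>n. cube (\<chi> i. - real (Suc n)) (2 * real (Suc n))) = (UNIV :: (real^'n) set)"
  proof (intro set_eqI iffI UNIV_I)
    fix x :: "real^'n"
    obtain n :: nat where n: "norm x < n" using reals_Archimedean2 by blast
    have "- real (Suc n) \<le> x $ i \<and> x $ i \<le> - real (Suc n) + 2 * real (Suc n)" for i
      using component_le_norm_cart[of x i] n by (auto simp: abs_le_iff)
    then show "x \<in> (\<Union>n. cube (\<chi> i. - real (Suc n)) (2 * real (Suc n)))"
      by (auto simp: mem_cube intro!: exI[of _ n])
  qed
  then show "\<exists>A. countable A \<and> A \<subseteq> sets \<mu> \<and> \<Union> A = space \<mu> \<and> (\<forall>a\<in>A. emeasure \<mu> a \<noteq> \<infinity>)"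
    using cube_finite by (intro exI[of _ "range (\<lambda>n. cube (\<chi> i. - real (Suc n)) (2 * real (Suc n)))"])
      (auto simp: less_top[symmetric])
qed

lemma weak_type_finite:
  assumes u [measurable]: "u \<in> borel_measurable \<mu>"
    and "finite T" "\<And>Q. Q \<in> T \<Longrightarrow> Q \<in> cubes \<and> c * emeasure \<mu> Q \<le> (\<integral>\<^sup>+y\<in>Q. u y \<partial>\<mu>)"
  shows "c * emeasure \<mu> (\<Union>T) \<le> ennreal D * (\<integral>\<^sup>+y. u y \<partial>\<mu>)"
proof -
  have "T \<subseteq> (\<lambda>(a, l). cube a l) ` {(a, l). 0 < l \<and> c * emeasure \<mu> (cube a l) \<le> (\<integral>\<^sup>+y\<in>cube a l. u y \<partial>\<mu>)}"
    using assms(3) by (fastforce simp: cubes_eq)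
  from finite_subset_image[OF assms(2) this]
  obtain P where P: "finite P" "T = (\<lambda>(a, l). cube a l) ` P"
      "P \<subseteq> {(a, l). 0 < l \<and> c * emeasure \<mu> (cube a l) \<le> (\<integral>\<^sup>+y\<in>cube a l. u y \<partial>\<mu>)}"
    by (elim exE conjE)
  obtain G where G: "G \<subseteq> P" "disjoint_family_on (\<lambda>(a, l). cube a l) G"
    "(\<Union>(a, l)\<in>P. cube a l) \<subseteq> (\<Union>(a, l)\<in>G. cube (\<chi> i. a $ i - l) (3 * l))"
    using Vitali_finite_cubes[OF P(1)] P(3) by blast
  have finG: "finite G" using G P finite_subset by blast
  have "emeasure \<mu> (\<Union>T) \<le> emeasure \<mu> (\<Union>(a, l)\<in>G. cube (\<chi> i. a $ i - l) (3 * l))"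
    using G(3) finG unfolding P(2) by (intro emeasure_mono) (auto intro!: sets.finite_UN)
  also have "\<dots> \<le> (\<Sum>(a, l)\<in>G. emeasure \<mu> (cube (\<chi> i. a $ i - l) (3 * l)))"
    using finG emeasure_subadditive_finite[OF finG, of "\<lambda>(a, l). cube (\<chi> i. a $ i - l) (3 * l)" \<mu>]
    by (auto simp: case_prod_unfold image_subset_iff)
  also have "\<dots> \<le> (\<Sum>(a, l)\<in>G. ennreal D * emeasure \<mu> (cube a l))"
    using G(1) P(3) by (intro sum_mono) (auto intro!: doubling)
  finally have "c * emeasure \<mu> (\<Union>T) \<le> c * (\<Sum>(a, l)\<in>G. ennreal D * emeasure \<mu> (cube a l))"
    by (rule mult_left_mono) simp
  also have "\<dots> = ennreal D * (\<Sum>(a, l)\<in>G. c * emeasure \<mu> (cube a l))"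
    by (simp add: sum_distrib_left case_prod_unfold mult_ac)
  also have "\<dots> \<le> ennreal D * (\<Sum>(a, l)\<in>G. emeasure (density \<mu> u) (cube a l))"
    using G(1) P(3) by (intro mult_left_mono sum_mono) (auto simp: emeasure_density)
  also have "(\<Sum>(a, l)\<in>G. emeasure (density \<mu> u) (cube a l)) = emeasure (density \<mu> u) (\<Union>(a, l)\<in>G. cube a l)"
    using sum_emeasure[OF _ G(2) finG, of "density \<mu> u"] by (auto simp: case_prod_unfold image_subset_iff)
  also have "\<dots> \<le> emeasure (density \<mu> u) (space (density \<mu> u))"
    by (rule emeasure_space)
  also have "\<dots> = (\<integral>\<^sup>+y. u y \<partial>\<mu>)"
    by (subst emeasure_density) auto
  finally show ?thesis by (simp add: mult_left_mono)
qed

lemma weak_type: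
  assumes u [measurable]: "u \<in> borel_measurable \<mu>"
  shows "c * emeasure \<mu> {x. c < maximal \<mu> u x} \<le> ennreal D * (\<integral>\<^sup>+y. u y \<partial>\<mu>)"
proof -
  define S where "S = {Q \<in> rational_cubes. c * emeasure \<mu> Q \<le> (\<integral>\<^sup>+y\<in>Q. u y \<partial>\<mu>)}"
  have S: "Q \<in> cubes" "Q \<in> sets \<mu>" if "Q \<in> S" for Q
    using that rational_cubes_subset cubes_lebesgue by (auto simp: S_def sets_eq)
  have countS: "countable S"
    unfolding S_def using countable_rational_cubes by (rule countable_subset[rotated]) auto
  have "{x. c < maximal \<mu> u x} \<subseteq> \<Union>S"
  proof safe
    fix x assume "c < maximal \<mu> u x"
    then obtain Q where Q: "Q \<in> rational_cubes" "c < indicator Q x * ((\<integral>\<^sup>+y\<in>Q. u y \<partial>\<mu>) / emeasure \<mu> Q)"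
      unfolding maximal_def less_SUP_iff by auto
    then have x: "x \<in> Q" by (cases "x \<in> Q") auto
    have fin: "0 < emeasure \<mu> Q" "emeasure \<mu> Q < top"
      using Q rational_cubes_subset cube_pos cube_finite by (auto simp: cubes_eq)
    have "c * emeasure \<mu> Q \<le> (\<integral>\<^sup>+y\<in>Q. u y \<partial>\<mu>) / emeasure \<mu> Q * emeasure \<mu> Q"
      using Q x by (intro mult_right_mono) auto
    also have "\<dots> = (\<integral>\<^sup>+y\<in>Q. u y \<partial>\<mu>)"
      using fin by (simp add: ennreal_divide_times)
    finally show "x \<in> \<Union>S" using Q x by (auto simp: S_def)
  qed
  then have "c * emeasure \<mu> {x. c < maximal \<mu> u x} \<le> c * emeasure \<mu> (\<Union>S)"
    using countS S by (intro mult_left_mono emeasure_mono) auto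
  also have "c * emeasure \<mu> (\<Union>S) \<le> ennreal D * (\<integral>\<^sup>+y. u y \<partial>\<mu>)"
  proof (cases "S = {}")
    case False
    define A where "A n = (\<Union>(from_nat_into S ` {..n}))" for n
    have memS: "from_nat_into S n \<in> S" for n
      using False by (rule from_nat_into)
    have "\<Union>S = \<Union>(range (from_nat_into S))"
      using range_from_nat_into[OF False countS] by simp
    also have "\<dots> = (\<Union>n. A n)"
      unfolding A_def by auto
    finally have "\<Union>S = (\<Union>n. A n)" .
    moreover have "(SUP n. emeasure \<mu> (A n)) = emeasure \<mu> (\<Union>n. A n)"
      using memS S(2) by (intro SUP_emeasure_incseq) (force simp: A_def incseq_def intro!: sets.finite_UN)+
    ultimately have "c * emeasure \<mu> (\<Union>S) = c * (SUP n. emeasure \<mu> (A n))"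
      by simp
    also have "\<dots> = (SUP n. c * emeasure \<mu> (A n))"
      by (rule SUP_mult_left_ennreal)
    also have "\<dots> \<le> ennreal D * (\<integral>\<^sup>+y. u y \<partial>\<mu>)"
      unfolding A_def using memS S by (intro SUP_least weak_type_finite) (auto simp: S_def)
    finally show ?thesis .
  qed simp
  finally show ?thesis .
qed

lemma maximal_truncation:
  assumes [measurable]: "u \<in> borel_measurable \<mu>"
  shows "maximal \<mu> u x \<le> maximal \<mu> (\<lambda>x. u x * indicator {x. c < u x} x) x + c"
proof (rule maximal_least)
  fix Q assume Q: "Q \<in> rational_cubes" "x \<in> Q"
  have fin: "0 < emeasure \<mu> Q" "emeasure \<mu> Q < top" and [measurable]: "Q \<in> sets \<mu>"
    using Q rational_cubes_subset cube_pos cube_finite by (auto simp: cubes_eq)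
  have "(\<integral>\<^sup>+y\<in>Q. u y \<partial>\<mu>) \<le> (\<integral>\<^sup>+y. (u y * indicator {x. c < u x} y) * indicator Q y + c * indicator Q y \<partial>\<mu>)"
    by (intro nn_integral_mono) (auto simp: indicator_def)
  also have "\<dots> = (\<integral>\<^sup>+y\<in>Q. (u y * indicator {x. c < u x} y) \<partial>\<mu>) + c * emeasure \<mu> Q"
    by (subst nn_integral_add) (auto simp: nn_integral_cmult_indicator)
  finally have "(\<integral>\<^sup>+y\<in>Q. u y \<partial>\<mu>) / emeasure \<mu> Q \<le>
      ((\<integral>\<^sup>+y\<in>Q. (u y * indicator {x. c < u x} y) \<partial>\<mu>) + c * emeasure \<mu> Q) / emeasure \<mu> Q"
    by (rule divide_right_mono_ennreal)
  also have "\<dots> = (\<integral>\<^sup>+y\<in>Q. (u y * indicator {x. c < u x} y) \<partial>\<mu>) / emeasure \<mu> Q + c"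
    using fin by (simp add: add_divide_distrib_ennreal ennreal_mult_divide_eq)
  also have "\<dots> \<le> maximal \<mu> (\<lambda>x. u x * indicator {x. c < u x} x) x + c"
    by (intro add_right_mono maximal_upper Q)
  finally show "(\<integral>\<^sup>+y\<in>Q. u y \<partial>\<mu>) / emeasure \<mu> Q \<le> \<dots>" .
qed

lemma strong_type:
  assumes u [measurable]: "u \<in> borel_measurable \<mu>" and s: "1 < s"
  shows "(\<integral>\<^sup>+x. epowr (maximal \<mu> u x) s \<partial>\<mu>)
           \<le> ennreal (2 powr s * s * D / (s - 1)) * (\<integral>\<^sup>+x. epowr (u x) s \<partial>\<mu>)"
proof -
  interpret pair_sigma_finite \<mu> lborel
    by standard
  note [measurable] = measurable_maximal[OF sets_eq]
  have layer: "epowr y (a + 1) = ennreal (a + 1) *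
      (\<integral>\<^sup>+t. (if 0 < t \<and> ennreal t < y then ennreal (t powr a) else 0) \<partial>lborel)" if "- 1 < a" for a y
    unfolding nn_integral_powr_below[OF that] ennreal_times_divide
    using that by (subst mult.commute) (simp add: ennreal_mult_divide_eq)
  have "(\<integral>\<^sup>+x. epowr (maximal \<mu> u x) s \<partial>\<mu>) = ennreal s * (\<integral>\<^sup>+x. (\<integral>\<^sup>+t.
      (if 0 < t \<and> ennreal t < maximal \<mu> u x then ennreal (t powr (s - 1)) else 0) \<partial>lborel) \<partial>\<mu>)"
    using s layer[of "s - 1"] by (simp add: nn_integral_cmult)
  also have "\<dots> = ennreal s * (\<integral>\<^sup>+t. (\<integral>\<^sup>+x.
      (if 0 < t \<and> ennreal t < maximal \<mu> u x then ennreal (t powr (s - 1)) else 0) \<partial>\<mu>) \<partial>lborel)"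
    by (subst Fubini') auto
  also have "\<dots> \<le> ennreal s * (\<integral>\<^sup>+t. (\<integral>\<^sup>+x. ennreal (2 * D) *
      (u x * (if 0 < t \<and> ennreal t < 2 * u x then ennreal (t powr (s - 2)) else 0)) \<partial>\<mu>) \<partial>lborel)"
  proof (rule mult_left_mono[OF nn_integral_mono])
    fix t :: real
    show "(\<integral>\<^sup>+x. (if 0 < t \<and> ennreal t < maximal \<mu> u x then ennreal (t powr (s - 1)) else 0) \<partial>\<mu>)
      \<le> (\<integral>\<^sup>+x. ennreal (2 * D) *
        (u x * (if 0 < t \<and> ennreal t < 2 * u x then ennreal (t powr (s - 2)) else 0)) \<partial>\<mu>)"
    proof (cases "0 < t")
      case t: True
      define v where "v x = u x * indicator {x. ennreal (t / 2) < u x} x" for x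
      have [measurable]: "v \<in> borel_measurable \<mu>" unfolding v_def by measurable
      have split: "ennreal t = ennreal (t / 2) + ennreal (t / 2)"
        using t by (simp flip: ennreal_plus)
      have "ennreal (t / 2) < maximal \<mu> v x" if "ennreal t < maximal \<mu> u x" for x
      proof (rule ccontr)
        assume "\<not> ?thesis"
        then have "maximal \<mu> u x \<le> ennreal (t / 2) + ennreal (t / 2)"
          using maximal_truncation[OF u, of x "ennreal (t / 2)"] unfolding v_def[symmetric]
          by (meson add_right_mono dual_order.trans not_less)
        then show False using that split by simp
      qed
      then have "ennreal (t / 2) * emeasure \<mu> {x. ennreal t < maximal \<mu> u x}
          \<le> ennreal (t / 2) * emeasure \<mu> {x. ennreal (t / 2) < maximal \<mu> v x}"
        by (intro mult_left_mono emeasure_mono) auto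
      also have "\<dots> \<le> ennreal D * (\<integral>\<^sup>+y. v y \<partial>\<mu>)"
        by (rule weak_type) measurable
      finally have w: "ennreal (t / 2) * emeasure \<mu> {x. ennreal t < maximal \<mu> u x} \<le> ennreal D * (\<integral>\<^sup>+y. v y \<partial>\<mu>)" .
      have "(\<integral>\<^sup>+x. (if 0 < t \<and> ennreal t < maximal \<mu> u x then ennreal (t powr (s - 1)) else 0) \<partial>\<mu>)
          = (\<integral>\<^sup>+x. ennreal (t powr (s - 1)) * indicator {x. ennreal t < maximal \<mu> u x} x \<partial>\<mu>)"
        using t by (intro nn_integral_cong) auto
      also have "\<dots> = ennreal (t powr (s - 1)) * emeasure \<mu> {x. ennreal t < maximal \<mu> u x}"
        by (subst nn_integral_cmult_indicator) auto
      also have "\<dots> = ennreal (2 * t powr (s - 2)) *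
          (ennreal (t / 2) * emeasure \<mu> {x. ennreal t < maximal \<mu> u x})"
      proof -
        have "t powr (s - 1) = t powr ((s - 2) + 1)" by simp
        also have "\<dots> = 2 * t powr (s - 2) * (t / 2)"
          unfolding powr_add using t by simp
        finally have "ennreal (t powr (s - 1)) = ennreal (2 * t powr (s - 2)) * ennreal (t / 2)"
          using t by (subst ennreal_mult[symmetric]) auto
        then show ?thesis by (simp only: mult.assoc)
      qed
      also have "\<dots> \<le> ennreal (2 * t powr (s - 2)) * (ennreal D * (\<integral>\<^sup>+y. v y \<partial>\<mu>))"
        by (intro mult_left_mono w) simp
      also have "\<dots> = (\<integral>\<^sup>+y. ennreal (2 * t powr (s - 2)) * (ennreal D * v y) \<partial>\<mu>)"
        by (simp add: nn_integral_cmult)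
      also have "\<dots> = (\<integral>\<^sup>+x. ennreal (2 * D) *
        (u x * (if 0 < t \<and> ennreal t < 2 * u x then ennreal (t powr (s - 2)) else 0)) \<partial>\<mu>)"
      proof (intro nn_integral_cong)
        fix x
        have "ennreal (t / 2) < u x \<longleftrightarrow> ennreal t < 2 * u x"
        proof -
          have "ennreal t = 2 * ennreal (t / 2)"
            using split by (simp add: mult_2)
          then show ?thesis
            using ennreal_mult_strict_left_mono[of "ennreal (t / 2)" "u x" 2]
              mult_left_mono[of "u x" "ennreal (t / 2)" 2] by (auto simp: not_less[symmetric])
        qed
        then show "ennreal (2 * t powr (s - 2)) * (ennreal D * v x) = ennreal (2 * D) *
          (u x * (if 0 < t \<and> ennreal t < 2 * u x then ennreal (t powr (s - 2)) else 0))"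
          using t D_nonneg by (simp add: v_def ennreal_mult mult_ac)
      qed
      finally show ?thesis .
    qed simp
  qed simp
  also have "\<dots> = ennreal s * (\<integral>\<^sup>+x. (\<integral>\<^sup>+t. ennreal (2 * D) *
      (u x * (if 0 < t \<and> ennreal t < 2 * u x then ennreal (t powr (s - 2)) else 0)) \<partial>lborel) \<partial>\<mu>)"
    by (subst Fubini') auto
  also have "\<dots> = ennreal s * (\<integral>\<^sup>+x. ennreal (2 * D) *
      (u x * (epowr (2 * u x) (s - 1) / ennreal (s - 1))) \<partial>\<mu>)"
    using nn_integral_powr_below[of "s - 2"] s by (simp add: nn_integral_cmult)
  also have "\<dots> = ennreal s * (\<integral>\<^sup>+x. ennreal (2 powr s * D / (s - 1)) * epowr (u x) s \<partial>\<mu>)"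
  proof (intro arg_cong[where f="\<lambda>z. ennreal s * z"] nn_integral_cong)
    fix x
    have "epowr (u x) s = u x * epowr (u x) (s - 1)"
      using epowr_add_nonneg[of 1 "s - 1" "u x"] s by simp
    moreover have "epowr (2 * u x) (s - 1) = ennreal (2 powr (s - 1)) * epowr (u x) (s - 1)"
      using s epowr_ennreal[of 2 "s - 1"] by (simp add: epowr_mult)
    moreover have "ennreal (2 powr s * D / (s - 1)) = ennreal (2 * D) * ennreal (2 powr (s - 1)) / ennreal (s - 1)"
      using s D_nonneg powr_add[of 2 1 "s - 1"] by (simp add: divide_ennreal flip: ennreal_mult)
    ultimately show "ennreal (2 * D) * (u x * (epowr (2 * u x) (s - 1) / ennreal (s - 1)))
        = ennreal (2 powr s * D / (s - 1)) * epowr (u x) s"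
      by (simp add: divide_ennreal_def mult_ac)
  qed
  also have "\<dots> = ennreal s * ennreal (2 powr s * D / (s - 1)) * (\<integral>\<^sup>+x. epowr (u x) s \<partial>\<mu>)"
    by (simp add: nn_integral_cmult mult.assoc)
  also have "ennreal s * ennreal (2 powr s * D / (s - 1)) = ennreal (2 powr s * s * D / (s - 1))"
    using s D_nonneg by (simp flip: ennreal_mult)
  finally show ?thesis .
qed

end

section \<open>Muckenhoupt weights\<close>

definition Muckenhoupt :: "(real^'n \<Rightarrow> ennreal) \<Rightarrow> real \<Rightarrow> real \<Rightarrow> bool" where
  "Muckenhoupt V t A \<longleftrightarrow> weight V \<and> 1 < t \<and> 0 \<le> A \<and>
     (\<forall>Q\<in>cubes. (\<integral>\<^sup>+x\<in>Q. V x \<partial>lebesgue) * epowr (\<integral>\<^sup>+x\<in>Q. epowr (V x) (- 1 / (t - 1)) \<partial>lebesgue) (t - 1)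
        \<le> ennreal A * epowr (emeasure lebesgue Q) t)"

lemma cube_in_cubes: "0 < l \<Longrightarrow> cube a l \<in> cubes"
  by (auto simp: cubes_eq)

lemma weight_epowr: "weight V \<Longrightarrow> weight (\<lambda>x. epowr (V x) a)"
  unfolding weight_def
  by (cases a "0 :: real" rule: linorder_cases) (auto simp: epowr_pos_iff epowr_less_top_iff)

lemma Muckenhoupt_dual:
  assumes "Muckenhoupt V t A"
  shows "Muckenhoupt (\<lambda>x. epowr (V x) (- 1 / (t - 1))) (t / (t - 1)) (A powr (1 / (t - 1)))"
proof -
  have t: "1 < t" "0 \<le> A" and V: "weight V"
    and A: "\<And>Q. Q \<in> cubes \<Longrightarrow> (\<integral>\<^sup>+x\<in>Q. V x \<partial>lebesgue) * epowr (\<integral>\<^sup>+x\<in>Q. epowr (V x) (- 1 / (t - 1)) \<partial>lebesgue) (t - 1)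
        \<le> ennreal A * epowr (emeasure lebesgue Q) t"
    using assms by (auto simp: Muckenhoupt_def)
  have e: "t / (t - 1) - 1 = 1 / (t - 1)" using t by (simp add: field_simps)
  have "(- 1 / (t - 1)) * (- 1 / (1 / (t - 1))) = 1" using t by (simp add: field_simps)
  then have VV: "epowr (epowr (V x) (- 1 / (t - 1))) (- 1 / (t / (t - 1) - 1)) = V x" for x
    unfolding epowr_epowr e by (simp only: epowr_1_right)
  have "(\<integral>\<^sup>+x\<in>Q. epowr (V x) (- 1 / (t - 1)) \<partial>lebesgue) * epowr (\<integral>\<^sup>+x\<in>Q. V x \<partial>lebesgue) (t / (t - 1) - 1)
        \<le> ennreal (A powr (1 / (t - 1))) * epowr (emeasure lebesgue Q) (t / (t - 1))" if "Q \<in> cubes" for Q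
  proof -
    have "epowr ((\<integral>\<^sup>+x\<in>Q. V x \<partial>lebesgue) * epowr (\<integral>\<^sup>+x\<in>Q. epowr (V x) (- 1 / (t - 1)) \<partial>lebesgue) (t - 1)) (1 / (t - 1))
        \<le> epowr (ennreal A * epowr (emeasure lebesgue Q) t) (1 / (t - 1))"
      using t by (intro epowr_mono A that) auto
    moreover have "epowr (ennreal A) (1 / (t - 1)) = ennreal (A powr (1 / (t - 1)))"
      using t by (cases "A = 0") (auto simp: epowr_simps)
    ultimately show ?thesis
      using t unfolding e by (simp add: epowr_mult epowr_epowr mult.commute)
  qed
  then show ?thesis
    unfolding Muckenhoupt_def VV using weight_epowr[OF V] t by simp
qed

lemma weight_measurable: "weight V \<Longrightarrow> V \<in> borel_measurable lebesgue"
  by (simp add: weight_def)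

lemma weight_AE: "weight V \<Longrightarrow> AE x in lebesgue. 0 < V x \<and> V x < top"
  by (simp add: weight_def)

lemma weight_cube_pos:
  assumes V: "weight V" and Q: "Q \<in> cubes"
  shows "0 < (\<integral>\<^sup>+x\<in>Q. V x \<partial>lebesgue)"
proof (rule ccontr)
  have [measurable]: "Q \<in> sets lebesgue" using Q by (rule cubes_lebesgue)
  note [measurable] = weight_measurable[OF V]
  assume "\<not> ?thesis"
  then have "AE x in lebesgue. V x * indicator Q x = 0"
    by (subst nn_integral_0_iff_AE[symmetric]) auto
  then have "AE x in lebesgue. x \<notin> Q"
    using weight_AE[OF V] by eventually_elim (auto simp: indicator_def split: if_splits)
  then have "emeasure lebesgue Q = 0"
    by (subst emeasure_eq_AE[of Q "{}"]) auto
  then show False using cubes_emeasure[OF Q] by simp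
qed

lemma Muckenhoupt_cube_finite:
  assumes M: "Muckenhoupt V t A" and Q: "Q \<in> cubes"
  shows "(\<integral>\<^sup>+x\<in>Q. V x \<partial>lebesgue) < top"
proof -
  have V: "weight V" and t: "1 < t" using M by (auto simp: Muckenhoupt_def)
  have "(\<integral>\<^sup>+x\<in>Q. V x \<partial>lebesgue) * epowr (\<integral>\<^sup>+x\<in>Q. epowr (V x) (- 1 / (t - 1)) \<partial>lebesgue) (t - 1)
        \<le> ennreal A * epowr (emeasure lebesgue Q) t"
    using M Q by (auto simp: Muckenhoupt_def)
  also have "\<dots> < top"
    using cubes_emeasure[OF Q] t by (auto simp: ennreal_mult_less_top epowr_less_top_iff)
  finally have "(\<integral>\<^sup>+x\<in>Q. V x \<partial>lebesgue) * epowr (\<integral>\<^sup>+x\<in>Q. epowr (V x) (- 1 / (t - 1)) \<partial>lebesgue) (t - 1) < top" .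
  moreover have "0 < epowr (\<integral>\<^sup>+x\<in>Q. epowr (V x) (- 1 / (t - 1)) \<partial>lebesgue) (t - 1)"
    using weight_cube_pos[OF weight_epowr[OF V] Q] t by (simp add: epowr_pos_iff)
  ultimately show ?thesis by (auto simp: ennreal_mult_less_top)
qed

lemma cube_le_weight_dual:
  assumes V: "weight V" and Q: "Q \<in> cubes" and t: "1 < t"
  shows "epowr (emeasure lebesgue Q) t \<le>
    (\<integral>\<^sup>+x\<in>Q. V x \<partial>lebesgue) * epowr (\<integral>\<^sup>+x\<in>Q. epowr (V x) (- 1 / (t - 1)) \<partial>lebesgue) (t - 1)"
proof -
  have [measurable]: "Q \<in> sets lebesgue" using Q by (rule cubes_lebesgue)
  note [measurable] = weight_measurable[OF V]
  have e: "1 - 1 / t = (t - 1) / t" using t by (simp add: field_simps)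
  have "emeasure lebesgue Q = (\<integral>\<^sup>+x. indicator Q x \<partial>lebesgue)" by simp
  also have "\<dots> = (\<integral>\<^sup>+x. epowr (V x * indicator Q x) (1 / t) *
      epowr (epowr (V x) (- 1 / (t - 1)) * indicator Q x) (1 - 1 / t) \<partial>lebesgue)"
  proof (intro nn_integral_cong_AE eventually_mono[OF weight_AE[OF V]])
    fix x assume x: "0 < V x \<and> V x < top"
    show "indicator Q x = epowr (V x * indicator Q x) (1 / t) *
      epowr (epowr (V x) (- 1 / (t - 1)) * indicator Q x) (1 - 1 / t)"
    proof (cases "x \<in> Q")
      case True
      then show ?thesis
        using x t epowr_add[of "V x" "1 / t" "- 1 / t"] by (simp add: e epowr_epowr)
    next
      case False
      then show ?thesis using t by (simp add: epowr_0_left)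
    qed
  qed
  also have "\<dots> \<le> epowr (\<integral>\<^sup>+x\<in>Q. V x \<partial>lebesgue) (1 / t) *
      epowr (\<integral>\<^sup>+x\<in>Q. epowr (V x) (- 1 / (t - 1)) \<partial>lebesgue) (1 - 1 / t)"
    using t by (intro nn_integral_Holder) auto
  finally have "epowr (emeasure lebesgue Q) t \<le> epowr (epowr (\<integral>\<^sup>+x\<in>Q. V x \<partial>lebesgue) (1 / t) *
      epowr (\<integral>\<^sup>+x\<in>Q. epowr (V x) (- 1 / (t - 1)) \<partial>lebesgue) (1 - 1 / t)) t"
    using t by (intro epowr_mono) auto
  also have "\<dots> = (\<integral>\<^sup>+x\<in>Q. V x \<partial>lebesgue) * epowr (\<integral>\<^sup>+x\<in>Q. epowr (V x) (- 1 / (t - 1)) \<partial>lebesgue) (t - 1)"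
    using t by (simp add: epowr_mult epowr_epowr e)
  finally show ?thesis .
qed

lemma Muckenhoupt_doubling:
  fixes V :: "real^'n \<Rightarrow> ennreal"
  assumes M: "Muckenhoupt V t A"
  shows "doubling_measure (density lebesgue V) (A * (3 ^ CARD('n)) powr t)"
proof
  have V: "weight V" and t: "1 < t" "0 \<le> A" using M by (auto simp: Muckenhoupt_def)
  note [measurable] = weight_measurable[OF V]
  have em: "emeasure (density lebesgue V) Q = (\<integral>\<^sup>+x\<in>Q. V x \<partial>lebesgue)" if "Q \<in> cubes" for Q
    using cubes_lebesgue[OF that] by (simp add: emeasure_density)
  show "sets (density lebesgue V) = sets lebesgue" by simp
  show "0 < emeasure (density lebesgue V) (cube a l)" if "0 < l" for a l
    using weight_cube_pos[OF V, of "cube a l"] that by (subst em) (auto intro: cube_in_cubes)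
  show "emeasure (density lebesgue V) (cube a l) < top" if "0 < l" for a l
    using Muckenhoupt_cube_finite[OF M, of "cube a l"] that by (subst em) (auto intro: cube_in_cubes)
  show "0 \<le> A * (3 ^ CARD('n)) powr t" using t by simp
  show "emeasure (density lebesgue V) (cube (\<chi> i. a $ i - l) (3 * l))
      \<le> ennreal (A * (3 ^ CARD('n)) powr t) * emeasure (density lebesgue V) (cube a l)" if l: "0 < l" for a l
  proof -
    define Q R where "Q = cube a l" and "R = cube (\<chi> i. a $ i - l) (3 * l)"
    have QR: "Q \<in> cubes" "R \<in> cubes" using l by (auto simp: Q_def R_def intro: cube_in_cubes)
    have sub: "Q \<subseteq> R"
    proof
      fix x assume x: "x \<in> Q"
      have "a $ i - l \<le> x $ i \<and> x $ i \<le> a $ i - l + 3 * l" for i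
        using x l by (auto simp: Q_def mem_cube dest!: spec[of _ i])
      then show "x \<in> R" by (simp add: R_def mem_cube)
    qed
    define S where "S Q = epowr (\<integral>\<^sup>+x\<in>Q. epowr (V x) (- 1 / (t - 1)) \<partial>lebesgue) (t - 1)" for Q
    have S: "0 < S R" "S R < top"
      using weight_cube_pos[OF weight_epowr[OF V] QR(2)] Muckenhoupt_cube_finite[OF Muckenhoupt_dual[OF M] QR(2)] t
      by (auto simp: S_def epowr_pos_iff epowr_less_top_iff)
    have SS: "S Q \<le> S R"
      unfolding S_def using t sub by (intro epowr_mono nn_integral_mono mult_left_mono) (auto simp: indicator_def)
    have R: "emeasure lebesgue R = ennreal (3 ^ CARD('n)) * emeasure lebesgue Q"
      unfolding Q_def R_def using l
      by (subst (1 2) emeasure_cube) (auto simp: power_mult_distrib simp flip: ennreal_mult)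
    have "(\<integral>\<^sup>+x\<in>R. V x \<partial>lebesgue) * S R \<le> ennreal A * epowr (emeasure lebesgue R) t"
      using M QR unfolding Muckenhoupt_def S_def by auto
    also have "\<dots> = ennreal (A * (3 ^ CARD('n)) powr t) * epowr (emeasure lebesgue Q) t"
      unfolding R using t by (simp add: epowr_mult epowr_ennreal ennreal_mult mult.assoc)
    also have "\<dots> \<le> ennreal (A * (3 ^ CARD('n)) powr t) * ((\<integral>\<^sup>+x\<in>Q. V x \<partial>lebesgue) * S Q)"
      unfolding S_def by (intro mult_left_mono cube_le_weight_dual V QR t) simp
    also have "\<dots> \<le> ennreal (A * (3 ^ CARD('n)) powr t) * ((\<integral>\<^sup>+x\<in>Q. V x \<partial>lebesgue) * S R)"
      by (intro mult_left_mono SS) auto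
    finally have "S R * (\<integral>\<^sup>+x\<in>R. V x \<partial>lebesgue) \<le> S R * (ennreal (A * (3 ^ CARD('n)) powr t) * (\<integral>\<^sup>+x\<in>Q. V x \<partial>lebesgue))"
      by (simp add: mult_ac)
    then have "(\<integral>\<^sup>+x\<in>R. V x \<partial>lebesgue) \<le> ennreal (A * (3 ^ CARD('n)) powr t) * (\<integral>\<^sup>+x\<in>Q. V x \<partial>lebesgue)"
      using S by (subst (asm) ennreal_mult_le_mult_iff) auto
    then show ?thesis
      using QR by (simp only: em Q_def R_def)
  qed
qed

text \<open>
  Lerner's domination of the maximal function by weighted maximal functions, which are bounded
  by doubling alone. This avoids reverse Hoelder inequalities.
\<close>

lemma maximal_pointwise:
  fixes V f :: "real^'n \<Rightarrow> ennreal"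
  assumes M: "Muckenhoupt V t A" and f [measurable]: "f \<in> borel_measurable lebesgue"
  defines "\<sigma> \<equiv> \<lambda>x. epowr (V x) (- 1 / (t - 1))"
  defines "g \<equiv> \<lambda>x. epowr (maximal (density lebesgue \<sigma>) (\<lambda>y. f y / \<sigma> y) x) (t - 1)"
  shows "epowr (maximal lebesgue f x) (t - 1) \<le> ennreal A * maximal (density lebesgue V) (\<lambda>y. g y / V y) x"
proof -
  have V: "weight V" and t: "1 < t" "0 \<le> A" using M by (auto simp: Muckenhoupt_def)
  note [measurable] = weight_measurable[OF V]
  have \<sigma>: "weight \<sigma>" unfolding \<sigma>_def by (rule weight_epowr[OF V])
  note [measurable] = weight_measurable[OF \<sigma>]
  have g [measurable]: "g \<in> borel_measurable lebesgue"
    using measurable_maximal[of "density lebesgue \<sigma>" "\<lambda>y. f y / \<sigma> y"] unfolding g_def by measurable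
  have "maximal lebesgue f x \<le> epowr (ennreal A * maximal (density lebesgue V) (\<lambda>y. g y / V y) x) (1 / (t - 1))"
  proof (rule maximal_least)
    fix Q assume Q: "Q \<in> rational_cubes" "x \<in> Q"
    have Qc: "Q \<in> cubes" using Q rational_cubes_subset by auto
    have [measurable]: "Q \<in> sets lebesgue" using Qc by (rule cubes_lebesgue)
    define I q vQ sQ m G where "I = (\<integral>\<^sup>+y\<in>Q. f y \<partial>lebesgue)" and "q = emeasure lebesgue Q"
      and "vQ = (\<integral>\<^sup>+x\<in>Q. V x \<partial>lebesgue)" and "sQ = (\<integral>\<^sup>+x\<in>Q. \<sigma> x \<partial>lebesgue)"
      and "m = I / sQ" and "G = (\<integral>\<^sup>+y\<in>Q. g y \<partial>lebesgue)"
    have q: "0 < q" "q < top" using cubes_emeasure[OF Qc] by (auto simp: q_def)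
    have vQ: "0 < vQ" "vQ < top"
      using weight_cube_pos[OF V Qc] Muckenhoupt_cube_finite[OF M Qc] by (auto simp: vQ_def)
    have sQ: "0 < sQ" "sQ < top"
      using weight_cube_pos[OF \<sigma> Qc] Muckenhoupt_cube_finite[OF Muckenhoupt_dual[OF M] Qc] by (auto simp: sQ_def \<sigma>_def)
    have A: "vQ * epowr sQ (t - 1) \<le> ennreal A * epowr q t"
      using M Qc by (auto simp: Muckenhoupt_def vQ_def sQ_def \<sigma>_def q_def)
    have I: "(\<integral>\<^sup>+y\<in>Q. (f y / \<sigma> y) \<partial>density lebesgue \<sigma>) = I"
      unfolding I_def
    proof (subst nn_integral_density; (measurable)?)
      show "(\<integral>\<^sup>+y. \<sigma> y * (f y / \<sigma> y * indicator Q y) \<partial>lebesgue) = (\<integral>\<^sup>+y\<in>Q. f y \<partial>lebesgue)"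
        by (intro nn_integral_cong_AE eventually_mono[OF weight_AE[OF \<sigma>]])
           (auto simp: ennreal_times_divide ennreal_mult_divide_eq mult.commute[of _ "f _"] indicator_def)
    qed
    have GG: "(\<integral>\<^sup>+y\<in>Q. (g y / V y) \<partial>density lebesgue V) = G"
      unfolding G_def
    proof (subst nn_integral_density; (measurable)?)
      show "(\<integral>\<^sup>+y. V y * (g y / V y * indicator Q y) \<partial>lebesgue) = (\<integral>\<^sup>+y\<in>Q. g y \<partial>lebesgue)"
        by (intro nn_integral_cong_AE eventually_mono[OF weight_AE[OF V]])
           (auto simp: ennreal_times_divide ennreal_mult_divide_eq mult.commute[of _ "g _"] indicator_def)
    qed
    have emv: "emeasure (density lebesgue V) Q = vQ" "emeasure (density lebesgue \<sigma>) Q = sQ"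
      by (simp_all add: emeasure_density vQ_def sQ_def)
    have m: "m \<le> maximal (density lebesgue \<sigma>) (\<lambda>y. f y / \<sigma> y) y" if "y \<in> Q" for y
      using maximal_upper[OF Q(1) that, of "density lebesgue \<sigma>" "\<lambda>y. f y / \<sigma> y"]
      by (simp add: I emv m_def)
    have "epowr m (t - 1) * q = (\<integral>\<^sup>+y. epowr m (t - 1) * indicator Q y \<partial>lebesgue)"
      by (simp add: nn_integral_cmult_indicator q_def)
    also have "\<dots> \<le> G"
      unfolding G_def g_def using t
      by (intro nn_integral_mono) (auto simp: indicator_def intro!: epowr_mono m)
    finally have mG: "epowr m (t - 1) * q \<le> G" .
    have I_eq: "I = m * sQ"
      unfolding m_def using sQ by (simp add: ennreal_divide_times)
    have qt: "epowr q t = q * epowr q (t - 1)"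
      using epowr_add[OF q, of 1 "t - 1"] by simp
    have q1: "0 < epowr q (t - 1)" "epowr q (t - 1) < top"
      using q t by (auto simp: epowr_pos_iff epowr_less_top_iff)
    have "epowr (I / q) (t - 1) * vQ = epowr m (t - 1) * (vQ * epowr sQ (t - 1)) / epowr q (t - 1)"
      using t unfolding I_eq by (simp add: epowr_mult divide_ennreal_def epowr_inverse inverse_epowr mult_ac)
    also have "\<dots> \<le> epowr m (t - 1) * (ennreal A * epowr q t) / epowr q (t - 1)"
      by (intro divide_right_mono_ennreal mult_left_mono A) simp
    also have "\<dots> = ennreal A * (epowr m (t - 1) * q) * epowr q (t - 1) / epowr q (t - 1)"
      unfolding qt by (simp add: mult_ac)
    also have "\<dots> = ennreal A * (epowr m (t - 1) * q)"
      using q1 by (simp add: ennreal_mult_divide_eq)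
    also have "\<dots> \<le> ennreal A * G" by (intro mult_left_mono mG) simp
    finally have "epowr (I / q) (t - 1) * vQ / vQ \<le> ennreal A * G / vQ"
      by (rule divide_right_mono_ennreal)
    then have "epowr (I / q) (t - 1) \<le> ennreal A * (G / vQ)"
      using vQ by (simp add: ennreal_mult_divide_eq ennreal_times_divide)
    also have "G / vQ \<le> maximal (density lebesgue V) (\<lambda>y. g y / V y) x"
      using maximal_upper[OF Q, of "density lebesgue V" "\<lambda>y. g y / V y"] by (simp add: GG emv)
    finally have "epowr (I / q) (t - 1) \<le> ennreal A * maximal (density lebesgue V) (\<lambda>y. g y / V y) x"
      by (simp add: mult_left_mono)
    then show "(\<integral>\<^sup>+y\<in>Q. f y \<partial>lebesgue) / emeasure lebesgue Q
        \<le> epowr (ennreal A * maximal (density lebesgue V) (\<lambda>y. g y / V y) x) (1 / (t - 1))"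
      using t by (subst epowr_le_iff[symmetric]) (auto simp: I_def q_def)
  qed
  then show ?thesis
    using t by (subst epowr_le_iff) auto
qed

theorem Muckenhoupt_maximal:
  assumes t: "1 < t" and A0: "0 \<le> A"
  shows "\<exists>C::real. 0 \<le> C \<and> (\<forall>V f :: real^'n \<Rightarrow> ennreal. Muckenhoupt V t A \<longrightarrow> f \<in> borel_measurable lebesgue \<longrightarrow>
       (\<integral>\<^sup>+x. epowr (maximal lebesgue f x) t * V x \<partial>lebesgue) \<le> ennreal C * (\<integral>\<^sup>+x. epowr (f x) t * V x \<partial>lebesgue))"
proof -
  define t' where "t' = t / (t - 1)"
  define D E where "D = A * (3 ^ CARD('n)) powr t" and "E = A powr (1 / (t - 1)) * (3 ^ CARD('n)) powr t'"
  define C1 C2 where "C1 = 2 powr t' * t' * D / (t' - 1)" and "C2 = 2 powr t * t * E / (t - 1)"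
  have t': "1 < t'" using t by (simp add: t'_def field_simps)
  have t'1: "1 - t' = - 1 / (t - 1)" using t by (simp add: t'_def field_simps)
  have C: "0 \<le> C1" "0 \<le> C2" using t t' A0 by (auto simp: C1_def C2_def D_def E_def)
  show ?thesis
  proof (rule exI[of _ "A powr t' * C1 * C2"], intro conjI allI impI)
    show "0 \<le> A powr t' * C1 * C2" using C by simp
    fix V f :: "real^'n \<Rightarrow> ennreal"
    assume M: "Muckenhoupt V t A" and f [measurable]: "f \<in> borel_measurable lebesgue"
    have V: "weight V" using M by (auto simp: Muckenhoupt_def)
    define \<sigma> where "\<sigma> = (\<lambda>x. epowr (V x) (- 1 / (t - 1)))"
    have \<sigma>: "weight \<sigma>" unfolding \<sigma>_def by (rule weight_epowr[OF V])
    note [measurable] = weight_measurable[OF V] weight_measurable[OF \<sigma>]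
    define h where "h = maximal (density lebesgue \<sigma>) (\<lambda>y. f y / \<sigma> y)"
    define g where "g x = epowr (h x) (t - 1)" for x
    have [measurable]: "h \<in> borel_measurable lebesgue"
      using measurable_maximal[of "density lebesgue \<sigma>" "\<lambda>y. f y / \<sigma> y"] unfolding h_def by measurable
    have [measurable]: "g \<in> borel_measurable lebesgue" unfolding g_def by measurable
    have [measurable]: "maximal (density lebesgue V) (\<lambda>y. g y / V y) \<in> borel_measurable lebesgue"
      using measurable_maximal[of "density lebesgue V" "\<lambda>y. g y / V y"] by measurable
    interpret V: doubling_measure "density lebesgue V" D
      unfolding D_def by (rule Muckenhoupt_doubling[OF M])
    interpret S: doubling_measure "density lebesgue \<sigma>" E
      using Muckenhoupt_doubling[OF Muckenhoupt_dual[OF M]] unfolding E_def \<sigma>_def t'_def .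
    have "(\<integral>\<^sup>+x. epowr (maximal lebesgue f x) t * V x \<partial>lebesgue)
        \<le> (\<integral>\<^sup>+x. ennreal (A powr t') * (V x * epowr (maximal (density lebesgue V) (\<lambda>y. g y / V y) x) t') \<partial>lebesgue)"
    proof (intro nn_integral_mono)
      fix x
      have "epowr (maximal lebesgue f x) t = epowr (epowr (maximal lebesgue f x) (t - 1)) t'"
        unfolding epowr_epowr using t by (simp add: t'_def)
      also have "\<dots> \<le> epowr (ennreal A * maximal (density lebesgue V) (\<lambda>y. g y / V y) x) t'"
        using maximal_pointwise[OF M f, of x] t' unfolding g_def h_def \<sigma>_def by (intro epowr_mono) auto
      also have "\<dots> = ennreal (A powr t') * epowr (maximal (density lebesgue V) (\<lambda>y. g y / V y) x) t'"
      proof -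
        have "epowr (ennreal A) t' = ennreal (A powr t')"
          using A0 t' by (cases "A = 0") (auto simp: epowr_simps)
        then show ?thesis using t' by (simp add: epowr_mult)
      qed
      finally have "epowr (maximal lebesgue f x) t \<le> ennreal (A powr t') *
          epowr (maximal (density lebesgue V) (\<lambda>y. g y / V y) x) t'" .
      from mult_right_mono[OF this, of "V x"]
      show "epowr (maximal lebesgue f x) t * V x \<le> ennreal (A powr t') *
          (V x * epowr (maximal (density lebesgue V) (\<lambda>y. g y / V y) x) t')"
        by (simp add: mult_ac)
    qed
    also have "\<dots> = ennreal (A powr t') *
        (\<integral>\<^sup>+x. epowr (maximal (density lebesgue V) (\<lambda>y. g y / V y) x) t' \<partial>density lebesgue V)"
      by (simp add: nn_integral_cmult nn_integral_density)
    also have "\<dots> \<le> ennreal (A powr t') * (ennreal C1 * (\<integral>\<^sup>+x. epowr (g x / V x) t' \<partial>density lebesgue V))"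
      unfolding C1_def by (intro mult_left_mono V.strong_type t') auto
    also have "(\<integral>\<^sup>+x. epowr (g x / V x) t' \<partial>density lebesgue V) = (\<integral>\<^sup>+x. V x * epowr (g x / V x) t' \<partial>lebesgue)"
      by (subst nn_integral_density) auto
    also have "\<dots> = (\<integral>\<^sup>+x. \<sigma> x * epowr (h x) t \<partial>lebesgue)"
    proof (intro nn_integral_cong_AE eventually_mono[OF weight_AE[OF V]])
      fix x assume x: "0 < V x \<and> V x < top"
      have "epowr (g x) t' = epowr (h x) t"
        unfolding g_def epowr_epowr using t by (simp add: t'_def)
      then have "V x * epowr (g x / V x) t' = epowr (h x) t * (epowr (V x) 1 * epowr (V x) (- t'))"
        using t' by (simp add: divide_ennreal_def epowr_mult epowr_inverse mult_ac)
      also have "epowr (V x) 1 * epowr (V x) (- t') = \<sigma> x"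
        using epowr_add[of "V x" 1 "- t'"] x t'1 by (simp add: \<sigma>_def)
      finally show "V x * epowr (g x / V x) t' = \<sigma> x * epowr (h x) t" by (simp add: mult.commute)
    qed
    also have "\<dots> = (\<integral>\<^sup>+x. epowr (h x) t \<partial>density lebesgue \<sigma>)"
      by (subst nn_integral_density) auto
    also have "\<dots> \<le> ennreal C2 * (\<integral>\<^sup>+x. epowr (f x / \<sigma> x) t \<partial>density lebesgue \<sigma>)"
      unfolding h_def C2_def by (intro S.strong_type t) auto
    also have "(\<integral>\<^sup>+x. epowr (f x / \<sigma> x) t \<partial>density lebesgue \<sigma>) = (\<integral>\<^sup>+x. \<sigma> x * epowr (f x / \<sigma> x) t \<partial>lebesgue)"
      by (subst nn_integral_density) auto
    also have "\<dots> = (\<integral>\<^sup>+x. epowr (f x) t * V x \<partial>lebesgue)"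
    proof (intro nn_integral_cong_AE eventually_mono[OF weight_AE[OF \<sigma>]])
      fix x assume x: "0 < \<sigma> x \<and> \<sigma> x < top"
      have "\<sigma> x * epowr (f x / \<sigma> x) t = epowr (f x) t * (epowr (\<sigma> x) 1 * epowr (\<sigma> x) (- t))"
        using t by (simp add: divide_ennreal_def epowr_mult epowr_inverse mult_ac)
      also have "epowr (\<sigma> x) 1 * epowr (\<sigma> x) (- t) = epowr (\<sigma> x) (1 - t)"
        using epowr_add[of "\<sigma> x" 1 "- t"] x by simp
      also have "\<dots> = epowr (V x) ((- 1 / (t - 1)) * (1 - t))"
        unfolding \<sigma>_def epowr_epowr ..
      also have "(- 1 / (t - 1)) * (1 - t) = 1" using t by (simp add: field_simps)
      finally show "\<sigma> x * epowr (f x / \<sigma> x) t = epowr (f x) t * V x" by simp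
    qed
    finally show "(\<integral>\<^sup>+x. epowr (maximal lebesgue f x) t * V x \<partial>lebesgue)
        \<le> ennreal (A powr t' * C1 * C2) * (\<integral>\<^sup>+x. epowr (f x) t * V x \<partial>lebesgue)"
      using C by (simp add: ennreal_mult mult_left_mono mult.assoc)
  qed
qed

section \<open>The Rubio de Francia algorithm\<close>

lemma sums_half_powers: "(\<Sum>k. ennreal ((1 / 2) ^ Suc k)) = 1"
proof -
  have "(\<Sum>k. ennreal ((1 / 2) ^ Suc k)) = ennreal 1"
    by (rule suminf_ennreal_eq[OF _ power_half_series]) (rule zero_le_power, simp)
  then show ?thesis by (simp only: ennreal_1)
qed

lemma epowr_Jensen_half:
  assumes t: "1 < t"
  shows "epowr (\<Sum>k. ennreal ((1 / 2) ^ Suc k) * a k) t \<le> (\<Sum>k. ennreal ((1 / 2) ^ Suc k) * epowr (a k) t)"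
proof -
  define c where "c k = ennreal ((1 / 2) ^ Suc k)" for k :: nat
  have c: "0 < c k" "c k < top" for k by (simp_all add: c_def)
  have "(\<Sum>k. c k * a k) = (\<integral>\<^sup>+k. c k * a k \<partial>count_space UNIV)"
    by (simp add: nn_integral_count_space_nat)
  also have "\<dots> = (\<integral>\<^sup>+k. epowr (c k * epowr (a k) t) (1 / t) * epowr (c k) (1 - 1 / t) \<partial>count_space UNIV)"
  proof (intro nn_integral_cong)
    fix k
    have "epowr (c k * epowr (a k) t) (1 / t) * epowr (c k) (1 - 1 / t)
        = (epowr (c k) (1 / t) * epowr (c k) (1 - 1 / t)) * a k"
      using t by (simp add: epowr_mult epowr_epowr mult_ac)
    also have "epowr (c k) (1 / t) * epowr (c k) (1 - 1 / t) = c k"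
      using epowr_add[OF c[of k], of "1 / t" "1 - 1 / t"] by simp
    finally show "c k * a k = epowr (c k * epowr (a k) t) (1 / t) * epowr (c k) (1 - 1 / t)" by simp
  qed
  also have "\<dots> \<le> epowr (\<integral>\<^sup>+k. c k * epowr (a k) t \<partial>count_space UNIV) (1 / t) *
      epowr (\<integral>\<^sup>+k. c k \<partial>count_space UNIV) (1 - 1 / t)"
    using t by (intro nn_integral_Holder) auto
  also have "(\<integral>\<^sup>+k. c k \<partial>count_space UNIV) = 1"
    by (simp only: nn_integral_count_space_nat c_def sums_half_powers)
  finally have "(\<Sum>k. c k * a k) \<le> epowr (\<Sum>k. c k * epowr (a k) t) (1 / t)"
    by (simp add: nn_integral_count_space_nat)
  then show ?thesis
    using t unfolding c_def by (subst epowr_le_iff) auto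
qed

lemma suminf_Suc_le: "(\<Sum>k. f (Suc k)) \<le> (\<Sum>k. f k :: ennreal)"
  unfolding suminf_eq_SUP
proof (rule SUP_least)
  fix n
  have "(\<Sum>i<n. f (Suc i)) \<le> (\<Sum>i<Suc n. f i)"
    unfolding sum.lessThan_Suc_shift by simp
  also have "\<dots> \<le> (SUP n. \<Sum>i<n. f i)" by (rule SUP_upper) simp
  finally show "(\<Sum>i<n. f (Suc i)) \<le> (SUP n. \<Sum>i<n. f i)" .
qed

text \<open>
  The weights \<open>2\<^sup>-\<^sup>k\<^sup>-\<^sup>1\<close> in the Rubio de Francia series sum to 1, so that convexity of the power
  replaces the Minkowski inequality.
\<close>

theorem Rubio_de_Francia:
  assumes t: "1 < t" and A0: "0 \<le> A"
  shows "\<exists>B::real. 0 < B \<and>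
    (\<forall>V u :: real^'n \<Rightarrow> ennreal. Muckenhoupt V t A \<longrightarrow> u \<in> borel_measurable lebesgue \<longrightarrow>
      (\<exists>\<rho> \<in> borel_measurable lebesgue. (\<forall>x. u x \<le> \<rho> x) \<and>
         (\<integral>\<^sup>+x. epowr (\<rho> x) t * V x \<partial>lebesgue) \<le> ennreal (2 powr t) * (\<integral>\<^sup>+x. epowr (u x) t * V x \<partial>lebesgue) \<and>
         (\<forall>Q\<in>cubes. \<forall>x\<in>Q. average Q \<rho> \<le> ennreal B * \<rho> x)))"
proof -
  obtain C0 :: real where C0: "0 \<le> C0"
    "\<forall>V f :: real^'n \<Rightarrow> ennreal. Muckenhoupt V t A \<longrightarrow> f \<in> borel_measurable lebesgue \<longrightarrow>
       (\<integral>\<^sup>+x. epowr (maximal lebesgue f x) t * V x \<partial>lebesgue) \<le> ennreal C0 * (\<integral>\<^sup>+x. epowr (f x) t * V x \<partial>lebesgue)"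
    using Muckenhoupt_maximal[OF t A0] by (elim exE conjE)
  define C where "C = max 1 C0"
  define b where "b = C powr (1 / t)"
  have C: "1 \<le> C" by (simp add: C_def)
  have b: "0 < b" using C by (simp add: b_def)
  show ?thesis
  proof (rule exI[of _ "3 ^ CARD('n) * (2 * b)"], intro conjI allI impI)
    show "0 < 3 ^ CARD('n) * (2 * b)" using b by simp
    fix V u :: "real^'n \<Rightarrow> ennreal"
    assume M: "Muckenhoupt V t A" and u [measurable]: "u \<in> borel_measurable lebesgue"
    have V: "weight V" using M by (auto simp: Muckenhoupt_def)
    note [measurable] = weight_measurable[OF V]
    define U where "U k = (maximal lebesgue ^^ k) u" for k
    have Um [measurable]: "U k \<in> borel_measurable lebesgue" for k
      by (cases k) (auto simp: U_def intro: measurable_maximal)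
    have U_bound: "(\<integral>\<^sup>+x. epowr (U k x) t * V x \<partial>lebesgue) \<le> ennreal (C ^ k) * (\<integral>\<^sup>+x. epowr (u x) t * V x \<partial>lebesgue)" for k
    proof (induction k)
      case (Suc k)
      have "(\<integral>\<^sup>+x. epowr (U (Suc k) x) t * V x \<partial>lebesgue) \<le> ennreal C0 * (\<integral>\<^sup>+x. epowr (U k x) t * V x \<partial>lebesgue)"
        using C0(2)[rule_format, OF M Um[of k]] by (simp add: U_def)
      also have "\<dots> \<le> ennreal C * (ennreal (C ^ k) * (\<integral>\<^sup>+x. epowr (u x) t * V x \<partial>lebesgue))"
        by (intro mult_mono Suc ennreal_leI) (auto simp: C_def)
      also have "\<dots> = ennreal (C ^ Suc k) * (\<integral>\<^sup>+x. epowr (u x) t * V x \<partial>lebesgue)"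
        using C by (simp add: ennreal_mult mult.assoc)
      finally show ?case .
    qed (simp add: U_def)
    define c where "c k = ennreal ((1 / 2) ^ Suc k)" for k :: nat
    define \<rho>' where "\<rho>' x = (\<Sum>k. c k * (ennreal ((1 / b) ^ k) * U k x))" for x
    have [measurable]: "\<rho>' \<in> borel_measurable lebesgue" unfolding \<rho>'_def by measurable
    show "\<exists>\<rho> \<in> borel_measurable lebesgue. (\<forall>x. u x \<le> \<rho> x) \<and>
         (\<integral>\<^sup>+x. epowr (\<rho> x) t * V x \<partial>lebesgue) \<le> ennreal (2 powr t) * (\<integral>\<^sup>+x. epowr (u x) t * V x \<partial>lebesgue) \<and>
         (\<forall>Q\<in>cubes. \<forall>x\<in>Q. average Q \<rho> \<le> ennreal (3 ^ CARD('n) * (2 * b)) * \<rho> x)"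
    proof (intro bexI[of _ "\<lambda>x. 2 * \<rho>' x"] conjI allI ballI)
      fix x
      have "c 0 * (ennreal ((1 / b) ^ 0) * U 0 x) \<le> \<rho>' x"
        unfolding \<rho>'_def suminf_eq_SUP
        by (rule SUP_upper2[of 1]) auto
      then have "2 * (ennreal (1 / 2) * u x) \<le> 2 * \<rho>' x"
        by (intro mult_left_mono) (auto simp: c_def U_def)
      also have "2 * (ennreal (1 / 2) * u x) = u x"
      proof -
        have "2 * ennreal (1 / 2) = 1"
          using ennreal_mult[of 2 "1 / 2"] by simp
        then show ?thesis by (simp add: mult.assoc[symmetric])
      qed
      finally show "u x \<le> 2 * \<rho>' x" .
    next
      have "(\<integral>\<^sup>+x. epowr (\<rho>' x) t * V x \<partial>lebesgue)
          \<le> (\<integral>\<^sup>+x. (\<Sum>k. c k * (ennreal ((1 / C) ^ k) * (epowr (U k x) t * V x))) \<partial>lebesgue)"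
      proof (intro nn_integral_mono)
        fix x
        have "epowr (\<rho>' x) t \<le> (\<Sum>k. c k * epowr (ennreal ((1 / b) ^ k) * U k x) t)"
          unfolding \<rho>'_def c_def by (rule epowr_Jensen_half[OF t])
        also have "\<dots> = (\<Sum>k. c k * (ennreal ((1 / C) ^ k) * epowr (U k x) t))"
        proof -
          have "((1 / b) ^ k) powr t = (1 / C) ^ k" for k
          proof -
            have "((1 / b) ^ k) powr t = (1 / b) powr (t * k)"
              using b by (simp add: powr_powr mult.commute flip: powr_realpow)
            also have "\<dots> = ((1 / b) powr t) powr k" by (simp add: powr_powr)
            also have "(1 / b) powr t = 1 / C"
              using C t by (simp add: b_def powr_powr powr_divide)
            finally show ?thesis using C by (simp add: powr_realpow)
          qed
          then show ?thesis using t b by (simp add: epowr_mult epowr_ennreal)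
        qed
        finally have "epowr (\<rho>' x) t * V x \<le> (\<Sum>k. c k * (ennreal ((1 / C) ^ k) * epowr (U k x) t)) * V x"
          by (rule mult_right_mono) simp
        then show "epowr (\<rho>' x) t * V x \<le> (\<Sum>k. c k * (ennreal ((1 / C) ^ k) * (epowr (U k x) t * V x)))"
          by (simp only: ennreal_suminf_multc[symmetric] mult.assoc)
      qed
      also have "\<dots> = (\<Sum>k. c k * (ennreal ((1 / C) ^ k) * (\<integral>\<^sup>+x. epowr (U k x) t * V x \<partial>lebesgue)))"
        by (subst nn_integral_suminf) (auto simp: nn_integral_cmult)
      also have "\<dots> \<le> (\<Sum>k. c k * (\<integral>\<^sup>+x. epowr (u x) t * V x \<partial>lebesgue))"
      proof (intro suminf_le mult_left_mono)
        fix k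
        have "ennreal ((1 / C) ^ k) * (\<integral>\<^sup>+x. epowr (U k x) t * V x \<partial>lebesgue)
            \<le> ennreal ((1 / C) ^ k) * (ennreal (C ^ k) * (\<integral>\<^sup>+x. epowr (u x) t * V x \<partial>lebesgue))"
          by (intro mult_left_mono U_bound) simp
        also have "\<dots> = ennreal ((1 / C) ^ k * C ^ k) * (\<integral>\<^sup>+x. epowr (u x) t * V x \<partial>lebesgue)"
          using C by (simp add: ennreal_mult mult.assoc)
        also have "(1 / C) ^ k * C ^ k = 1"
          using C by (simp add: power_one_over)
        finally show "ennreal ((1 / C) ^ k) * (\<integral>\<^sup>+x. epowr (U k x) t * V x \<partial>lebesgue)
            \<le> (\<integral>\<^sup>+x. epowr (u x) t * V x \<partial>lebesgue)" by simp
      qed auto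
      also have "\<dots> = (\<integral>\<^sup>+x. epowr (u x) t * V x \<partial>lebesgue)"
        by (simp only: ennreal_suminf_multc c_def sums_half_powers mult_1_left)
      finally have *: "(\<integral>\<^sup>+x. epowr (\<rho>' x) t * V x \<partial>lebesgue) \<le> (\<integral>\<^sup>+x. epowr (u x) t * V x \<partial>lebesgue)" .
      have "(\<integral>\<^sup>+x. epowr (2 * \<rho>' x) t * V x \<partial>lebesgue) = ennreal (2 powr t) * (\<integral>\<^sup>+x. epowr (\<rho>' x) t * V x \<partial>lebesgue)"
        using t epowr_ennreal[of 2 t] by (simp add: epowr_mult mult.assoc nn_integral_cmult)
      with * show "(\<integral>\<^sup>+x. epowr (2 * \<rho>' x) t * V x \<partial>lebesgue) \<le> ennreal (2 powr t) * (\<integral>\<^sup>+x. epowr (u x) t * V x \<partial>lebesgue)"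
        by (simp add: mult_left_mono)
    next
      fix Q :: "(real^'n) set" and x assume Q: "Q \<in> cubes" "x \<in> Q"
      obtain R where R: "R \<in> rational_cubes" "Q \<subseteq> R"
        "emeasure lebesgue R \<le> ennreal (3 ^ CARD('n)) * emeasure lebesgue Q"
        using rational_cube_superset[OF Q(1)] .
      have Rc: "R \<in> cubes" using R rational_cubes_subset by auto
      have [measurable]: "R \<in> sets lebesgue" using Rc by (rule cubes_lebesgue)
      have QR: "0 < emeasure lebesgue Q" "emeasure lebesgue Q < top" "0 < emeasure lebesgue R" "emeasure lebesgue R < top"
        by (rule cubes_emeasure[OF Q(1)] cubes_emeasure[OF Rc])+
      have "(\<integral>\<^sup>+y\<in>R. \<rho>' y \<partial>lebesgue) / emeasure lebesgue R
          = (\<Sum>k. c k * (ennreal ((1 / b) ^ k) * ((\<integral>\<^sup>+y\<in>R. U k y \<partial>lebesgue) / emeasure lebesgue R)))"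
      proof -
        have "(\<integral>\<^sup>+y\<in>R. \<rho>' y \<partial>lebesgue) = (\<integral>\<^sup>+y. (\<Sum>k. c k * (ennreal ((1 / b) ^ k) * (U k y * indicator R y))) \<partial>lebesgue)"
        proof (intro nn_integral_cong)
          fix y
          show "\<rho>' y * indicator R y = (\<Sum>k. c k * (ennreal ((1 / b) ^ k) * (U k y * indicator R y)))"
            unfolding \<rho>'_def ennreal_suminf_multc[symmetric] by (simp only: mult.assoc)
        qed
        also have "\<dots> = (\<Sum>k. c k * (ennreal ((1 / b) ^ k) * (\<integral>\<^sup>+y\<in>R. U k y \<partial>lebesgue)))"
          by (subst nn_integral_suminf) (auto simp: nn_integral_cmult)
        finally show ?thesis
          unfolding ennreal_times_divide ennreal_suminf_divide by simp
      qed
      also have "\<dots> \<le> (\<Sum>k. c k * (ennreal ((1 / b) ^ k) * U (Suc k) x))"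
      proof (intro suminf_le mult_left_mono)
        show "(\<integral>\<^sup>+y\<in>R. U k y \<partial>lebesgue) / emeasure lebesgue R \<le> U (Suc k) x" for k
          using maximal_upper[OF R(1), of x lebesgue "U k"] Q R(2) by (auto simp: U_def)
      qed auto
      also have "\<dots> = (\<Sum>k. ennreal (2 * b) * (c (Suc k) * (ennreal ((1 / b) ^ Suc k) * U (Suc k) x)))"
      proof (intro arg_cong[where f=suminf] ext)
        fix k
        have eq: "(1 / 2) ^ Suc k * (1 / b) ^ k = (2 * b) * ((1 / 2) ^ Suc (Suc k) * (1 / b) ^ Suc k)"
          using b by simp
        have "c k * ennreal ((1 / b) ^ k) = ennreal ((1 / 2) ^ Suc k * (1 / b) ^ k)"
          unfolding c_def using b by (intro ennreal_mult[symmetric]) auto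
        also have "\<dots> = ennreal (2 * b) * ennreal ((1 / 2) ^ Suc (Suc k) * (1 / b) ^ Suc k)"
          unfolding eq using b by (intro ennreal_mult) auto
        also have "ennreal ((1 / 2) ^ Suc (Suc k) * (1 / b) ^ Suc k) = c (Suc k) * ennreal ((1 / b) ^ Suc k)"
          unfolding c_def using b by (intro ennreal_mult) auto
        finally have "c k * ennreal ((1 / b) ^ k) * U (Suc k) x
            = ennreal (2 * b) * (c (Suc k) * ennreal ((1 / b) ^ Suc k)) * U (Suc k) x"
          by (rule arg_cong[where f = "\<lambda>z. z * U (Suc k) x"])
        then show "c k * (ennreal ((1 / b) ^ k) * U (Suc k) x) =
            ennreal (2 * b) * (c (Suc k) * (ennreal ((1 / b) ^ Suc k) * U (Suc k) x))"
          by (simp only: mult.assoc)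
      qed
      also have "\<dots> \<le> ennreal (2 * b) * \<rho>' x"
        unfolding \<rho>'_def ennreal_suminf_cmult
        using suminf_Suc_le[of "\<lambda>k. c k * (ennreal ((1 / b) ^ k) * U k x)"] by (rule mult_left_mono) simp
      finally have "(\<integral>\<^sup>+y\<in>R. \<rho>' y \<partial>lebesgue) / emeasure lebesgue R * emeasure lebesgue R
          \<le> ennreal (2 * b) * \<rho>' x * emeasure lebesgue R"
        by (rule mult_right_mono) simp
      then have "(\<integral>\<^sup>+y\<in>R. \<rho>' y \<partial>lebesgue) \<le> ennreal (2 * b) * \<rho>' x * emeasure lebesgue R"
        using QR by (simp add: ennreal_divide_times)
      also have "\<dots> \<le> ennreal (2 * b) * \<rho>' x * (ennreal (3 ^ CARD('n)) * emeasure lebesgue Q)"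
        by (intro mult_left_mono R) simp
      also have "\<dots> = ennreal (3 ^ CARD('n) * (2 * b)) * \<rho>' x * emeasure lebesgue Q"
        using b by (simp add: ennreal_mult mult_ac)
      finally have *: "(\<integral>\<^sup>+y\<in>R. \<rho>' y \<partial>lebesgue) \<le> ennreal (3 ^ CARD('n) * (2 * b)) * \<rho>' x * emeasure lebesgue Q" .
      have [measurable]: "Q \<in> sets lebesgue" using Q(1) by (rule cubes_lebesgue)
      have "(\<integral>\<^sup>+y\<in>Q. 2 * \<rho>' y \<partial>lebesgue) = 2 * (\<integral>\<^sup>+y\<in>Q. \<rho>' y \<partial>lebesgue)"
        by (simp add: mult.assoc nn_integral_cmult)
      also have "\<dots> \<le> 2 * (\<integral>\<^sup>+y\<in>R. \<rho>' y \<partial>lebesgue)"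
        using R(2) by (intro mult_left_mono nn_integral_mono) (auto simp: indicator_def)
      also have "\<dots> \<le> 2 * (ennreal (3 ^ CARD('n) * (2 * b)) * \<rho>' x * emeasure lebesgue Q)"
        by (intro mult_left_mono *) simp
      finally have "average Q (\<lambda>x. 2 * \<rho>' x) \<le> 2 * (ennreal (3 ^ CARD('n) * (2 * b)) * \<rho>' x * emeasure lebesgue Q) / emeasure lebesgue Q"
        unfolding average_def by (rule divide_right_mono_ennreal)
      also have "\<dots> = ennreal (3 ^ CARD('n) * (2 * b)) * (2 * \<rho>' x) * emeasure lebesgue Q / emeasure lebesgue Q"
        by (simp add: mult_ac)
      also have "\<dots> = ennreal (3 ^ CARD('n) * (2 * b)) * (2 * \<rho>' x)"
        using QR by (simp add: ennreal_mult_divide_eq)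
      finally show "average Q (\<lambda>x. 2 * \<rho>' x) \<le> ennreal (3 ^ CARD('n) * (2 * b)) * (2 * \<rho>' x)" .
    qed measurable
  qed
qed

section \<open>Weights in reciprocal exponents\<close>

text \<open>
  All exponents are reciprocals: \<open>a = 1/r\<close> and \<open>b = 1/p'\<close>, with 0 standing for the exponent
  \<open>\<infinity>\<close>.
\<close>

definition cube_norm :: "real \<Rightarrow> (real^'n) set \<Rightarrow> (real^'n \<Rightarrow> ennreal) \<Rightarrow> ennreal" where
  "cube_norm a Q v =
     (if a = 0 then esssup (lebesgue_on Q) v else epowr (average Q (\<lambda>x. epowr (v x) (1 / a))) a)"

definition A_rec :: "real \<Rightarrow> real \<Rightarrow> (real^'n \<Rightarrow> ennreal) \<Rightarrow> ennreal" where
  "A_rec a b v = (SUP Q\<in>cubes. cube_norm a Q v * cube_norm b Q (\<lambda>x. inverse (v x)))"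

lemma not_AE_notin_cube:
  assumes Q: "Q \<in> cubes" shows "\<not> (AE x in lebesgue. x \<notin> Q)"
proof
  assume "AE x in lebesgue. x \<notin> Q"
  then have "emeasure lebesgue Q = 0"
    using cubes_lebesgue[OF Q] by (subst emeasure_eq_AE[of Q "{}"]) auto
  then show False using cubes_emeasure[OF Q] by simp
qed

lemma inverse_inverse_ennreal: "inverse (inverse x) = (x :: ennreal)"
  by (cases x rule: ennreal_pos_cases) (auto simp: inverse_ennreal)

lemma A_rec_inverse: "A_rec b a (\<lambda>x. inverse (v x)) = A_rec a b v"
  by (simp add: A_rec_def inverse_inverse_ennreal mult.commute)

lemma weight_inverse: "weight v \<Longrightarrow> weight (\<lambda>x. inverse (v x))"
  using weight_epowr[of v "- 1"] epowr_inverse[of _ 1] by simp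

lemma weight_mult: "weight v \<Longrightarrow> weight w \<Longrightarrow> weight (\<lambda>x. v x * w x)"
  by (auto simp: weight_def ennreal_zero_less_mult_iff ennreal_mult_less_top)

lemma average_mono_AE: "AE x in lebesgue. x \<in> Q \<longrightarrow> f x \<le> g x \<Longrightarrow> average Q f \<le> average Q g"
  unfolding average_def
  by (intro divide_right_mono_ennreal nn_integral_mono_AE) (auto simp: indicator_def elim: eventually_mono)

lemma average_multc:
  assumes "Q \<in> cubes" "f \<in> borel_measurable lebesgue"
  shows "average Q (\<lambda>x. f x * c) = average Q f * c"
proof -
  note [measurable] = cubes_lebesgue[OF assms(1)] assms(2)
  have "(\<integral>\<^sup>+x\<in>Q. f x * c \<partial>lebesgue) = (\<integral>\<^sup>+x. (f x * indicator Q x) * c \<partial>lebesgue)"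
    by (simp add: mult_ac)
  also have "\<dots> = (\<integral>\<^sup>+x\<in>Q. f x \<partial>lebesgue) * c"
    by (rule nn_integral_multc) measurable
  finally show ?thesis by (simp add: average_def divide_ennreal_def mult_ac)
qed

lemma average_Holder:
  assumes Q: "Q \<in> cubes" and [measurable]: "f \<in> borel_measurable lebesgue" "g \<in> borel_measurable lebesgue"
    and \<theta>: "0 \<le> \<theta>" "\<theta> \<le> 1"
  shows "average Q (\<lambda>x. epowr (f x) \<theta> * epowr (g x) (1 - \<theta>)) \<le> epowr (average Q f) \<theta> * epowr (average Q g) (1 - \<theta>)"
proof -
  note [measurable] = cubes_lebesgue[OF Q]
  define q where "q = emeasure lebesgue Q"
  have q: "0 < q" "q < top" using cubes_emeasure[OF Q] by (auto simp: q_def)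
  have "(\<integral>\<^sup>+x\<in>Q. epowr (f x) \<theta> * epowr (g x) (1 - \<theta>) \<partial>lebesgue)
      \<le> (\<integral>\<^sup>+x. epowr (f x * indicator Q x) \<theta> * epowr (g x * indicator Q x) (1 - \<theta>) \<partial>lebesgue)"
    by (intro nn_integral_mono) (auto simp: indicator_def)
  also have "\<dots> \<le> epowr (\<integral>\<^sup>+x\<in>Q. f x \<partial>lebesgue) \<theta> * epowr (\<integral>\<^sup>+x\<in>Q. g x \<partial>lebesgue) (1 - \<theta>)"
    using \<theta> by (intro nn_integral_Holder) auto
  finally have "average Q (\<lambda>x. epowr (f x) \<theta> * epowr (g x) (1 - \<theta>))
      \<le> epowr (\<integral>\<^sup>+x\<in>Q. f x \<partial>lebesgue) \<theta> * epowr (\<integral>\<^sup>+x\<in>Q. g x \<partial>lebesgue) (1 - \<theta>) / q"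
    unfolding average_def q_def by (rule divide_right_mono_ennreal)
  also have "\<dots> = epowr (average Q f) \<theta> * epowr (average Q g) (1 - \<theta>)"
  proof -
    define X Y where "X = (\<integral>\<^sup>+x\<in>Q. f x \<partial>lebesgue)" and "Y = (\<integral>\<^sup>+x\<in>Q. g x \<partial>lebesgue)"
    have "inverse q = epowr (inverse q) \<theta> * epowr (inverse q) (1 - \<theta>)"
      using epowr_add_nonneg[of \<theta> "1 - \<theta>" "inverse q"] \<theta> by simp
    then have "epowr X \<theta> * epowr Y (1 - \<theta>) / q
        = epowr X \<theta> * epowr Y (1 - \<theta>) * (epowr (inverse q) \<theta> * epowr (inverse q) (1 - \<theta>))"
      unfolding divide_ennreal_def by (rule arg_cong)
    also have "\<dots> = epowr (X / q) \<theta> * epowr (Y / q) (1 - \<theta>)"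
      using \<theta> by (simp add: divide_ennreal_def epowr_mult mult_ac)
    finally show ?thesis by (simp only: average_def X_def Y_def q_def)
  qed
  finally show ?thesis .
qed

lemma A_rec_Muckenhoupt:
  assumes w: "weight w" and ab: "0 < a" "0 < b" and K: "A_rec a b w \<le> ennreal K" and K0: "0 < K"
  shows "Muckenhoupt (\<lambda>x. epowr (w x) (1 / a)) (1 + b / a) (K powr (1 / a))"
proof -
  have e: "1 / a * (- 1 / (1 + b / a - 1)) = - (1 / b)" using ab by simp
  have "(\<integral>\<^sup>+x\<in>Q. epowr (w x) (1 / a) \<partial>lebesgue) * epowr (\<integral>\<^sup>+x\<in>Q. epowr (w x) (- (1 / b)) \<partial>lebesgue) (b / a)
        \<le> ennreal (K powr (1 / a)) * epowr (emeasure lebesgue Q) (1 + b / a)" if Q: "Q \<in> cubes" for Q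
  proof -
    define q where "q = emeasure lebesgue Q"
    define X where "X = (\<integral>\<^sup>+x\<in>Q. epowr (w x) (1 / a) \<partial>lebesgue)"
    define Y where "Y = (\<integral>\<^sup>+x\<in>Q. epowr (w x) (- (1 / b)) \<partial>lebesgue)"
    have q: "0 < q" "q < top" using cubes_emeasure[OF Q] by (auto simp: q_def)
    have "cube_norm a Q w * cube_norm b Q (\<lambda>x. inverse (w x)) \<le> ennreal K"
      using K Q unfolding A_rec_def by (meson SUP_upper order_trans)
    then have "epowr (X / q) a * epowr (Y / q) b \<le> ennreal K"
      using ab by (simp add: cube_norm_def average_def q_def X_def Y_def epowr_inverse)
    then have "epowr (epowr (X / q) a * epowr (Y / q) b) (1 / a) \<le> epowr (ennreal K) (1 / a)"
      using ab by (intro epowr_mono) auto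
    then have "(X / q) * epowr (Y / q) (b / a) \<le> ennreal (K powr (1 / a))"
      using ab K0 by (simp add: epowr_mult epowr_epowr epowr_ennreal)
    then have "(X / q) * epowr (Y / q) (b / a) * epowr q (1 + b / a) \<le> ennreal (K powr (1 / a)) * epowr q (1 + b / a)"
      by (rule mult_right_mono) simp
    also have "(X / q) * epowr (Y / q) (b / a) * epowr q (1 + b / a) = (X / q * q) * epowr (Y / q * q) (b / a)"
      using ab by (simp add: epowr_add_nonneg epowr_mult mult_ac)
    also have "\<dots> = X * epowr Y (b / a)"
      using q by (simp add: ennreal_divide_times)
    finally show ?thesis unfolding X_def Y_def q_def .
  qed
  then show ?thesis
    unfolding Muckenhoupt_def epowr_epowr e using weight_epowr[OF w] ab by simp
qed

lemma cube_norm_A1_power: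
  assumes w: "weight w" and Q: "Q \<in> cubes" and a: "0 < a" "0 \<le> a0" and s: "0 \<le> s"
    and rho: "weight \<rho>" "\<And>x. x \<in> Q \<Longrightarrow> average Q \<rho> \<le> ennreal B * \<rho> x" and B: "0 < B"
    and W: "weight W" "AE x in lebesgue. W x = epowr (w x) (a0 / a) * epowr (\<rho> x) (- s)"
  shows "cube_norm a0 Q W \<le> epowr (average Q (\<lambda>x. epowr (w x) (1 / a))) a0 * (ennreal (B powr s) * epowr (average Q \<rho>) (- s))"
proof -
  note [measurable] = cubes_lebesgue[OF Q] weight_measurable[OF w] weight_measurable[OF W(1)]
  define c where "c = ennreal (B powr s) * epowr (average Q \<rho>) (- s)"
  have c: "epowr (\<rho> x) (- s) \<le> c" if "x \<in> Q" for x
  proof -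
    have "epowr (\<rho> x) (- s) = ennreal (B powr s) * epowr (ennreal B * \<rho> x) (- s)"
    proof (cases "s = 0")
      case False
      have "epowr (ennreal B * \<rho> x) (- s) = epowr (inverse (ennreal B) * inverse (\<rho> x)) s"
        using B by (subst epowr_inverse[symmetric], subst ennreal_inverse_mult') auto
      also have "\<dots> = ennreal (B powr - s) * epowr (\<rho> x) (- s)"
        using s B by (simp add: epowr_mult epowr_inverse epowr_ennreal)
      finally have "ennreal (B powr s) * epowr (ennreal B * \<rho> x) (- s)
          = ennreal (B powr s * B powr - s) * epowr (\<rho> x) (- s)"
        by (simp add: ennreal_mult mult.assoc)
      then show ?thesis using B by (simp flip: powr_add)
    qed (use B in simp)
    also have "\<dots> \<le> c"
      unfolding c_def using s by (intro mult_left_mono epowr_antimono rho that) auto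
    finally show ?thesis .
  qed
  show ?thesis
  proof (cases "a0 = 0")
    case True
    have "esssup (lebesgue_on Q) W \<le> c"
    proof (rule esssup_I)
      show "W \<in> borel_measurable (lebesgue_on Q)"
        by (rule measurable_restrict_space1[OF weight_measurable[OF W(1)]])
      have "AE x in lebesgue. x \<in> Q \<longrightarrow> W x \<le> c"
        using W(2) by (rule eventually_mono) (use True c in auto)
      then show "AE x in lebesgue_on Q. W x \<le> c"
        by (subst AE_restrict_space_iff) auto
    qed
    then show ?thesis using True by (simp add: cube_norm_def c_def)
  next
    case False
    then have a0: "0 < a0" using a by simp
    have "average Q (\<lambda>x. epowr (W x) (1 / a0)) \<le> average Q (\<lambda>x. epowr (w x) (1 / a) * epowr c (1 / a0))"
    proof (rule average_mono_AE, rule eventually_mono[OF W(2)])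
      fix x assume x: "W x = epowr (w x) (a0 / a) * epowr (\<rho> x) (- s)"
      show "x \<in> Q \<longrightarrow> epowr (W x) (1 / a0) \<le> epowr (w x) (1 / a) * epowr c (1 / a0)"
      proof
        assume "x \<in> Q"
        have "epowr (W x) (1 / a0) = epowr (w x) (1 / a) * epowr (epowr (\<rho> x) (- s)) (1 / a0)"
          unfolding x using a0 by (simp add: epowr_mult epowr_epowr)
        also have "\<dots> \<le> epowr (w x) (1 / a) * epowr c (1 / a0)"
          using a0 by (intro mult_left_mono epowr_mono c \<open>x \<in> Q\<close>) auto
        finally show "epowr (W x) (1 / a0) \<le> epowr (w x) (1 / a) * epowr c (1 / a0)" .
      qed
    qed
    also have "\<dots> = average Q (\<lambda>x. epowr (w x) (1 / a)) * epowr c (1 / a0)"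
      by (rule average_multc[OF Q]) measurable
    finally have "epowr (average Q (\<lambda>x. epowr (W x) (1 / a0))) a0 \<le> epowr (average Q (\<lambda>x. epowr (w x) (1 / a)) * epowr c (1 / a0)) a0"
      using a0 by (intro epowr_mono) auto
    also have "\<dots> = epowr (average Q (\<lambda>x. epowr (w x) (1 / a))) a0 * c"
      using a0 by (simp add: epowr_mult epowr_epowr)
    finally show ?thesis using a0 by (simp add: cube_norm_def c_def)
  qed
qed

lemma A_rec_A1_power:
  assumes w: "weight w" and ab: "0 < a" "0 < b" "0 \<le> a0" "0 < d" "a = a0 + d"
    and K: "A_rec a b w \<le> ennreal K" "0 < K"
    and rho: "weight \<rho>" "\<And>Q x. Q \<in> cubes \<Longrightarrow> x \<in> Q \<Longrightarrow> average Q \<rho> \<le> ennreal B * \<rho> x" and B: "0 < B"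
    and W: "weight W" "AE x in lebesgue. W x = epowr (w x) (a0 / a) * epowr (\<rho> x) (- ((1 + b / a) * d))"
  shows "A_rec a0 (b + d) W \<le> ennreal (B powr ((1 + b / a) * d) * K powr (a0 / a))"
  unfolding A_rec_def
proof (rule SUP_least)
  fix Q :: "(real^'a) set" assume Q: "Q \<in> cubes"
  note [measurable] = cubes_lebesgue[OF Q] weight_measurable[OF w] weight_measurable[OF W(1)] weight_measurable[OF rho(1)]
  define s where "s = (1 + b / a) * d"
  have s: "0 < s" using ab by (simp add: s_def add_pos_pos)
  define X where "X = average Q (\<lambda>x. epowr (w x) (1 / a))"
  define Y where "Y = average Q (\<lambda>x. epowr (w x) (- (1 / b)))"
  define R where "R = average Q \<rho>"
  define \<theta> where "\<theta> = a0 * b / (a * (b + d))"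
  have \<theta>: "1 - \<theta> = s / (b + d)"
  proof -
    have nz: "a * (b + d) \<noteq> 0" and e: "1 + b / a = (a + b) / a"
      using ab by (auto simp: add_divide_distrib)
    have "1 - \<theta> = (a * (b + d) - a0 * b) / (a * (b + d))"
      using nz by (simp add: \<theta>_def diff_divide_distrib)
    also have "a * (b + d) - a0 * b = (a + b) * d"
      using ab by (simp add: algebra_simps)
    also have "(a + b) * d / (a * (b + d)) = s / (b + d)"
      unfolding s_def e by simp
    finally show ?thesis .
  qed
  have \<theta>01: "0 \<le> \<theta>" "\<theta> \<le> 1"
  proof -
    show "0 \<le> \<theta>" using ab by (simp add: \<theta>_def)
    have "0 \<le> s / (b + d)" using s ab by simp
    then show "\<theta> \<le> 1" using \<theta> by linarith
  qed
  have R: "0 < R" "R < top"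
  proof -
    show "0 < R" unfolding R_def average_def
      using weight_cube_pos[OF rho(1) Q] cubes_emeasure[OF Q] by (simp add: ennreal_zero_less_divide)
    obtain x where "x \<in> Q" "\<rho> x < top"
      using weight_AE[OF rho(1)] not_AE_notin_cube[OF Q] by (metis (mono_tags, lifting) eventually_mono)
    then show "R < top"
      using rho(2)[OF Q, of x] unfolding R_def
      by (meson ennreal_less_top ennreal_mult_less_top order_le_less_trans)
  qed
  have one: "cube_norm a0 Q W \<le> epowr X a0 * (ennreal (B powr s) * epowr R (- s))"
    unfolding X_def R_def using W s ab
    by (intro cube_norm_A1_power[OF w Q _ _ _ rho(1) rho(2)[OF Q] B]) (auto simp: s_def)
  have "average Q (\<lambda>x. epowr (inverse (W x)) (1 / (b + d)))
      \<le> average Q (\<lambda>x. epowr (epowr (w x) (- (1 / b))) \<theta> * epowr (\<rho> x) (1 - \<theta>))"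
  proof (rule average_mono_AE)
    show "AE x in lebesgue. x \<in> Q \<longrightarrow> epowr (inverse (W x)) (1 / (b + d))
        \<le> epowr (epowr (w x) (- (1 / b))) \<theta> * epowr (\<rho> x) (1 - \<theta>)"
      using W(2) weight_AE[OF w] weight_AE[OF rho(1)]
    proof eventually_elim
      case (elim x)
      have "epowr (inverse (W x)) (1 / (b + d)) = epowr (W x) (- (1 / (b + d)))"
        by (rule epowr_inverse)
      also have "\<dots> = epowr (epowr (w x) (a0 / a)) (- (1 / (b + d))) * epowr (epowr (\<rho> x) (- s)) (- (1 / (b + d)))"
        using elim s ab unfolding elim(1) s_def[symmetric]
        by (intro epowr_mult_finite) (auto simp: epowr_pos_iff epowr_less_top_iff zero_less_divide_iff)
      also have "\<dots> = epowr (epowr (w x) (- (1 / b))) \<theta> * epowr (\<rho> x) (1 - \<theta>)"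
      proof -
        have "a0 / a * (- (1 / (b + d))) = - (1 / b) * \<theta>" using ab by (simp add: \<theta>_def)
        moreover have "- s * (- (1 / (b + d))) = 1 - \<theta>" by (simp add: \<theta>)
        ultimately show ?thesis by (simp only: epowr_epowr)
      qed
      finally show ?case by simp
    qed
  qed
  also have "\<dots> \<le> epowr Y \<theta> * epowr R (1 - \<theta>)"
    unfolding Y_def R_def by (intro average_Holder Q \<theta>01) measurable
  finally have "cube_norm (b + d) Q (\<lambda>x. inverse (W x)) \<le> epowr (epowr Y \<theta> * epowr R (1 - \<theta>)) (b + d)"
    using ab by (simp add: cube_norm_def epowr_mono)
  also have "\<dots> = epowr Y (b * (a0 / a)) * epowr R s"
    using ab by (simp add: epowr_mult epowr_epowr \<theta>) (simp add: \<theta>_def mult.commute)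
  finally have two: "cube_norm (b + d) Q (\<lambda>x. inverse (W x)) \<le> epowr Y (b * (a0 / a)) * epowr R s" .
  have "cube_norm a0 Q W * cube_norm (b + d) Q (\<lambda>x. inverse (W x))
      \<le> (epowr X a0 * (ennreal (B powr s) * epowr R (- s))) * (epowr Y (b * (a0 / a)) * epowr R s)"
    by (intro mult_mono one two) auto
  also have "\<dots> = ennreal (B powr s) * (epowr X a0 * epowr Y (b * (a0 / a))) * (epowr R (- s) * epowr R s)"
    by (simp add: mult_ac)
  also have "epowr R (- s) * epowr R s = 1"
    using epowr_add[OF R, of "- s" s] by simp
  also have "epowr X a0 * epowr Y (b * (a0 / a)) = epowr (epowr X a * epowr Y b) (a0 / a)"
    using ab by (simp add: epowr_mult epowr_epowr)
  also have "ennreal (B powr s) * epowr (epowr X a * epowr Y b) (a0 / a) * 1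
      \<le> ennreal (B powr s) * epowr (ennreal K) (a0 / a) * 1"
  proof (intro mult_left_mono mult_right_mono epowr_mono)
    have "cube_norm a Q w * cube_norm b Q (\<lambda>x. inverse (w x)) \<le> ennreal K"
      using K Q unfolding A_rec_def by (meson SUP_upper order_trans)
    then show "epowr X a * epowr Y b \<le> ennreal K"
      using ab by (simp add: cube_norm_def X_def Y_def epowr_inverse)
  qed (use ab in auto)
  also have "\<dots> = ennreal (B powr s * K powr (a0 / a))"
    using K(2) by (simp add: epowr_ennreal ennreal_mult)
  finally show "cube_norm a0 Q W * cube_norm (b + d) Q (\<lambda>x. inverse (W x))
      \<le> ennreal (B powr ((1 + b / a) * d) * K powr (a0 / a))"
    unfolding s_def .
qed

lemma ex_positive_integrable:
  "\<exists>G :: real^'n \<Rightarrow> ennreal. G \<in> borel_measurable lebesgue \<and> (\<forall>x. 0 < G x \<and> G x < top) \<and>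
     0 < (\<integral>\<^sup>+x. G x \<partial>lebesgue) \<and> (\<integral>\<^sup>+x. G x \<partial>lebesgue) < top"
proof -
  obtain G :: "real^'n \<Rightarrow> ennreal" where G: "G \<in> borel_measurable lborel" "integral\<^sup>N lborel G \<noteq> \<infinity>"
      "\<forall>x\<in>space lborel. 0 < G x \<and> G x < \<infinity>"
    using sigma_finite_measure.Ex_finite_integrable_function[OF sigma_finite_lborel] by blast
  have G': "G \<in> borel_measurable lebesgue"
    using measurable_completion[OF G(1)] .
  have "(\<integral>\<^sup>+x. G x \<partial>lebesgue) < top"
    using G(2) nn_integral_completion[of lborel G] G(1) by (simp add: less_top[symmetric])
  moreover have "(\<integral>\<^sup>+x. G x \<partial>lebesgue) \<noteq> 0"
  proof
    assume "(\<integral>\<^sup>+x. G x \<partial>lebesgue) = 0"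
    then have "AE x in lebesgue. G x = 0" using G' by (simp add: nn_integral_0_iff_AE)
    moreover have "G x \<noteq> 0" for x
      using G(3)[rule_format, of x] by auto
    ultimately have "AE x in (lebesgue :: (real^'n) measure). False"
      by simp
    then have "AE x in lebesgue. x \<notin> cube (0 :: real^'n) 1"
      by (rule eventually_mono) simp
    then show False
      using not_AE_notin_cube[OF cube_in_cubes[of 1 "0 :: real^'n"]] by simp
  qed
  ultimately show ?thesis using G G' by (auto intro!: exI[of _ G] simp: zero_less_iff_neq_zero)
qed

theorem extrapolation_weight:
  assumes ab: "0 < a" "0 < b" "0 \<le> a0" "0 < d" "a = a0 + d" and K: "0 < K"
  shows "\<exists>C::real. 0 < C \<and> (\<forall>w H :: real^'n \<Rightarrow> ennreal. weight w \<longrightarrow> A_rec a b w \<le> ennreal K \<longrightarrow>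
      H \<in> borel_measurable lebesgue \<longrightarrow> (\<integral>\<^sup>+x. H x \<partial>lebesgue) \<le> 1 \<longrightarrow>
      (\<exists>h. weight h \<and> (AE x in lebesgue. H x \<le> h x) \<and> (\<integral>\<^sup>+x. h x \<partial>lebesgue) \<le> ennreal C \<and>
         A_rec a0 (b + d) (\<lambda>x. w x * epowr (h x) (- d)) \<le> ennreal C))"
proof -
  define t where "t = 1 + b / a"
  have t: "1 < t" using ab by (simp add: t_def)
  obtain B :: real where B: "0 < B" and rdf: "\<forall>V u :: real^'n \<Rightarrow> ennreal. Muckenhoupt V t (K powr (1 / a)) \<longrightarrow> u \<in> borel_measurable lebesgue \<longrightarrow>
      (\<exists>\<rho> \<in> borel_measurable lebesgue. (\<forall>x. u x \<le> \<rho> x) \<and>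
         (\<integral>\<^sup>+x. epowr (\<rho> x) t * V x \<partial>lebesgue) \<le> ennreal (2 powr t) * (\<integral>\<^sup>+x. epowr (u x) t * V x \<partial>lebesgue) \<and>
         (\<forall>Q\<in>cubes. \<forall>x\<in>Q. average Q \<rho> \<le> ennreal B * \<rho> x))"
    using Rubio_de_Francia[OF t powr_ge_zero[of K "1 / a"]] by (elim exE conjE)
  obtain G :: "real^'n \<Rightarrow> ennreal" where [measurable]: "G \<in> borel_measurable lebesgue" and G: "\<forall>x. 0 < G x \<and> G x < top"
     "(\<integral>\<^sup>+x. G x \<partial>lebesgue) < top"
    using ex_positive_integrable by blast
  define c where "c = enn2real (\<integral>\<^sup>+x. G x \<partial>lebesgue)"
  have c: "(\<integral>\<^sup>+x. G x \<partial>lebesgue) = ennreal c" "0 \<le> c"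
    using G(2) by (auto simp: c_def)
  define C where "C = max (2 powr t * (1 + c)) (B powr (t * d) * K powr (a0 / a))"
  show ?thesis
  proof (rule exI[of _ C], intro conjI allI impI)
    show "0 < C" using c by (simp add: C_def less_max_iff_disj add_pos_nonneg)
    fix w H :: "real^'n \<Rightarrow> ennreal"
    assume w: "weight w" and wK: "A_rec a b w \<le> ennreal K" and [measurable]: "H \<in> borel_measurable lebesgue"
      and H: "(\<integral>\<^sup>+x. H x \<partial>lebesgue) \<le> 1"
    define V where "V x = epowr (w x) (1 / a)" for x
    have V: "weight V" unfolding V_def by (rule weight_epowr[OF w])
    have M: "Muckenhoupt V t (K powr (1 / a))"
      unfolding V_def t_def by (rule A_rec_Muckenhoupt[OF w ab(1,2) wK K])
    note [measurable] = weight_measurable[OF w] weight_measurable[OF V]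
    define u where "u x = epowr ((H x + G x) / V x) (1 / t)" for x
    have [measurable]: "u \<in> borel_measurable lebesgue" unfolding u_def by measurable
    obtain \<rho> where [measurable]: "\<rho> \<in> borel_measurable lebesgue" and \<rho>: "\<forall>x. u x \<le> \<rho> x"
         "(\<integral>\<^sup>+x. epowr (\<rho> x) t * V x \<partial>lebesgue) \<le> ennreal (2 powr t) * (\<integral>\<^sup>+x. epowr (u x) t * V x \<partial>lebesgue)"
         "\<forall>Q\<in>cubes. \<forall>x\<in>Q. average Q \<rho> \<le> ennreal B * \<rho> x"
      using rdf[rule_format, OF M, of u] by auto
    define h where "h x = epowr (\<rho> x) t * V x" for x
    have [measurable]: "h \<in> borel_measurable lebesgue" unfolding h_def by measurable
    have uV: "AE x in lebesgue. epowr (u x) t * V x = H x + G x"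
      using weight_AE[OF V]
    proof eventually_elim
      case (elim x)
      have "epowr (u x) t = (H x + G x) / V x" unfolding u_def epowr_epowr using t by simp
      moreover have "V x \<noteq> 0" "V x < top" using elim by auto
      ultimately show ?case by (simp add: ennreal_divide_times)
    qed
    have hHG: "AE x in lebesgue. H x + G x \<le> h x"
      using uV
    proof eventually_elim
      case (elim x)
      have "epowr (u x) t * V x \<le> h x"
        unfolding h_def using \<rho>(1) t by (intro mult_right_mono epowr_mono) auto
      then show ?case using elim by simp
    qed
    have int_h: "(\<integral>\<^sup>+x. h x \<partial>lebesgue) \<le> ennreal (2 powr t * (1 + c))"
    proof -
      have "(\<integral>\<^sup>+x. epowr (u x) t * V x \<partial>lebesgue) = (\<integral>\<^sup>+x. H x + G x \<partial>lebesgue)"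
        by (rule nn_integral_cong_AE[OF uV])
      also have "\<dots> = (\<integral>\<^sup>+x. H x \<partial>lebesgue) + ennreal c"
        using c by (simp add: nn_integral_add)
      also have "\<dots> \<le> 1 + ennreal c" by (rule add_right_mono[OF H])
      also have "\<dots> = ennreal (1 + c)" using c by simp
      finally have "ennreal (2 powr t) * (\<integral>\<^sup>+x. epowr (u x) t * V x \<partial>lebesgue) \<le> ennreal (2 powr t) * ennreal (1 + c)"
        by (rule mult_left_mono) simp
      with \<rho>(2) show ?thesis
        unfolding h_def using c by (simp add: ennreal_mult order_trans)
    qed
    have h: "weight h"
      unfolding weight_def
    proof
      have "(\<integral>\<^sup>+x. h x \<partial>lebesgue) \<noteq> \<infinity>"
        using int_h by (auto simp: top_unique)
      then have "AE x in lebesgue. h x \<noteq> \<infinity>"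
        by (intro nn_integral_PInf_AE) auto
      with hHG show "AE x in lebesgue. 0 < h x \<and> h x < \<infinity>"
      proof eventually_elim
        case (elim x)
        have "0 < H x + G x" using G(1) by (simp add: add_nonneg_pos)
        then show ?case using elim by (auto simp: less_top)
      qed
    qed simp
    have rho: "weight \<rho>"
      unfolding weight_def
    proof
      show "AE x in lebesgue. 0 < \<rho> x \<and> \<rho> x < \<infinity>"
        using weight_AE[OF h] weight_AE[OF V]
      proof eventually_elim
        case (elim x)
        then show ?case
          using t by (cases "\<rho> x" rule: ennreal_pos_cases) (auto simp: h_def epowr_simps ennreal_top_mult split: if_splits)
      qed
    qed simp
    define W where "W x = w x * epowr (h x) (- d)" for x
    have W: "weight W" unfolding W_def by (intro weight_mult w weight_epowr h)
    have Weq: "AE x in lebesgue. W x = epowr (w x) (a0 / a) * epowr (\<rho> x) (- (t * d))"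
      using weight_AE[OF w] weight_AE[OF V] weight_AE[OF rho]
    proof eventually_elim
      case (elim x)
      have "epowr (h x) (- d) = epowr (epowr (\<rho> x) t) (- d) * epowr (V x) (- d)"
        unfolding h_def using elim t by (intro epowr_mult_finite) (auto simp: epowr_pos_iff epowr_less_top_iff)
      also have "\<dots> = epowr (\<rho> x) (- (t * d)) * epowr (w x) (- (d / a))"
        by (simp add: V_def epowr_epowr)
      finally have "W x = (epowr (w x) 1 * epowr (w x) (- (d / a))) * epowr (\<rho> x) (- (t * d))"
        by (simp add: W_def mult_ac)
      also have "epowr (w x) 1 * epowr (w x) (- (d / a)) = epowr (w x) (a0 / a)"
      proof -
        have "1 - d / a = a0 / a" using ab by (simp add: field_simps)
        then show ?thesis using epowr_add[of "w x" 1 "- (d / a)"] elim by simp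
      qed
      finally show ?case .
    qed
    have "A_rec a0 (b + d) W \<le> ennreal (B powr ((1 + b / a) * d) * K powr (a0 / a))"
      using \<rho>(3) Weq unfolding t_def by (intro A_rec_A1_power[OF w ab wK K rho _ B W]) auto
    also have "\<dots> \<le> ennreal C" by (intro ennreal_leI) (simp add: C_def t_def)
    finally have AW: "A_rec a0 (b + d) W \<le> ennreal C" .
    show "\<exists>h. weight h \<and> (AE x in lebesgue. H x \<le> h x) \<and> (\<integral>\<^sup>+x. h x \<partial>lebesgue) \<le> ennreal C \<and>
         A_rec a0 (b + d) (\<lambda>x. w x * epowr (h x) (- d)) \<le> ennreal C"
    proof (intro exI[of _ h] conjI h)
      show "AE x in lebesgue. H x \<le> h x"
        using hHG by (rule eventually_mono) (meson add_increasing2 order_trans order_refl zero_le le_iff_add)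
      show "(\<integral>\<^sup>+x. h x \<partial>lebesgue) \<le> ennreal C"
        using int_h by (rule order_trans) (auto simp: C_def intro: ennreal_leI)
      show "A_rec a0 (b + d) (\<lambda>x. w x * epowr (h x) (- d)) \<le> ennreal C"
        using AW unfolding W_def .
    qed
  qed
qed

section \<open>Extrapolation\<close>

definition Lnorm_rec :: "real \<Rightarrow> (real^'n \<Rightarrow> ennreal) \<Rightarrow> ennreal" where
  "Lnorm_rec a f = (if a = 0 then esssup lebesgue f else epowr (\<integral>\<^sup>+x. epowr (f x) (1 / a) \<partial>lebesgue) a)"

lemma Lnorm_eq_rec:
  assumes "0 < q" shows "Lnorm q f = Lnorm_rec (real_of_ereal (1 / q)) f"
  using assms by (cases q) (auto simp: Lnorm_def Lnorm_rec_def one_ereal_def)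

lemma A_const_eq_rec:
  assumes "1 \<le> p" "0 < r"
  shows "A_const p r v = A_rec (real_of_ereal (1 / r)) (1 - real_of_ereal (1 / p)) v"
proof -
  have first: "(if r = \<infinity> then esssup (lebesgue_on Q) v
         else epowr (average Q (\<lambda>x. epowr (v x) (real_of_ereal r))) (1 / real_of_ereal r))
      = cube_norm (real_of_ereal (1 / r)) Q v" for Q
    using assms(2) by (cases r) (auto simp: cube_norm_def one_ereal_def)
  have second: "(if p = 1 then esssup (lebesgue_on Q) (\<lambda>x. inverse (v x))
         else epowr (average Q (\<lambda>x. epowr (v x) (- real_of_ereal (conj_exponent p))))
                (1 / real_of_ereal (conj_exponent p)))
      = cube_norm (1 - real_of_ereal (1 / p)) Q (\<lambda>x. inverse (v x))" for Q
  proof (cases p)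
    case (real x)
    show ?thesis
    proof (cases "x = 1")
      case True
      then show ?thesis by (simp add: cube_norm_def real one_ereal_def)
    next
      case False
      then have x: "1 < x" using assms(1) real by (simp add: one_ereal_def)
      have "real_of_ereal (conj_exponent p) = x / (x - 1)"
        using x by (simp add: conj_exponent_def real one_ereal_def)
      moreover have "1 - real_of_ereal (1 / p) = 1 / (x / (x - 1))" "1 - real_of_ereal (1 / p) \<noteq> 0"
        using x by (auto simp: real one_ereal_def field_simps)
      ultimately show ?thesis
        using x by (simp add: cube_norm_def epowr_inverse real one_ereal_def)
    qed
  next
    case PInf
    have "epowr (v x) (- 1) = inverse (v x)" for x
      using epowr_inverse[of "v x" 1] by simp
    with PInf show ?thesis by (simp add: cube_norm_def conj_exponent_def one_ereal_def)
  qed (use assms in simp)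
  show ?thesis unfolding A_const_def A_rec_def first second ..
qed

lemma Lnorm_rec_mono_AE:
  assumes "0 \<le> a" "f \<in> borel_measurable lebesgue" "AE x in lebesgue. f x \<le> g x"
  shows "Lnorm_rec a f \<le> Lnorm_rec a g"
proof (cases "a = 0")
  case True
  then show ?thesis using assms by (simp add: Lnorm_rec_def esssup_AE_mono)
next
  case False
  have "AE x in lebesgue. epowr (f x) (1 / a) \<le> epowr (g x) (1 / a)"
    using assms(3) by (rule eventually_mono) (use assms(1) in \<open>auto intro: epowr_mono\<close>)
  then show ?thesis
    using assms(1) False by (auto simp: Lnorm_rec_def intro!: epowr_mono nn_integral_mono_AE)
qed

lemma Lnorm_rec_Holder:
  assumes a: "0 \<le> a" and d: "0 < d" and [measurable]: "f \<in> borel_measurable lebesgue" "h \<in> borel_measurable lebesgue"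
  shows "Lnorm_rec (a + d) (\<lambda>x. f x * epowr (h x) d) \<le> Lnorm_rec a f * epowr (\<integral>\<^sup>+x. h x \<partial>lebesgue) d"
proof (cases "a = 0")
  case True
  define M where "M = esssup lebesgue f"
  have "(\<integral>\<^sup>+x. epowr (f x * epowr (h x) d) (1 / d) \<partial>lebesgue) \<le> (\<integral>\<^sup>+x. epowr M (1 / d) * h x \<partial>lebesgue)"
  proof (rule nn_integral_mono_AE, rule eventually_mono[OF esssup_AE[of f lebesgue]])
    fix x assume "f x \<le> esssup lebesgue f"
    then show "epowr (f x * epowr (h x) d) (1 / d) \<le> epowr M (1 / d) * h x"
      using d by (auto simp: epowr_mult epowr_epowr M_def intro!: mult_right_mono epowr_mono)
  qed
  also have "\<dots> = epowr M (1 / d) * (\<integral>\<^sup>+x. h x \<partial>lebesgue)"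
    by (simp add: nn_integral_cmult)
  finally have "epowr (\<integral>\<^sup>+x. epowr (f x * epowr (h x) d) (1 / d) \<partial>lebesgue) d
      \<le> epowr (epowr M (1 / d) * (\<integral>\<^sup>+x. h x \<partial>lebesgue)) d"
    using d by (intro epowr_mono) auto
  then show ?thesis
    using d True by (simp add: Lnorm_rec_def epowr_mult epowr_epowr M_def)
next
  case False
  define \<theta> where "\<theta> = a / (a + d)"
  have \<theta>: "0 \<le> \<theta>" "\<theta> \<le> 1" "1 - \<theta> = d / (a + d)"
    using a d by (auto simp: \<theta>_def field_simps)
  have "(\<integral>\<^sup>+x. epowr (f x * epowr (h x) d) (1 / (a + d)) \<partial>lebesgue)
      = (\<integral>\<^sup>+x. epowr (epowr (f x) (1 / a)) \<theta> * epowr (h x) (1 - \<theta>) \<partial>lebesgue)"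
    using a d False by (simp add: epowr_mult epowr_epowr \<theta>(3)) (simp add: \<theta>_def)
  also have "\<dots> \<le> epowr (\<integral>\<^sup>+x. epowr (f x) (1 / a) \<partial>lebesgue) \<theta> * epowr (\<integral>\<^sup>+x. h x \<partial>lebesgue) (1 - \<theta>)"
    using \<theta> by (intro nn_integral_Holder) auto
  finally have "epowr (\<integral>\<^sup>+x. epowr (f x * epowr (h x) d) (1 / (a + d)) \<partial>lebesgue) (a + d)
      \<le> epowr (epowr (\<integral>\<^sup>+x. epowr (f x) (1 / a) \<partial>lebesgue) \<theta> * epowr (\<integral>\<^sup>+x. h x \<partial>lebesgue) (1 - \<theta>)) (a + d)"
    using a d by (intro epowr_mono) auto
  also have "\<dots> = epowr (\<integral>\<^sup>+x. epowr (f x) (1 / a) \<partial>lebesgue) a * epowr (\<integral>\<^sup>+x. h x \<partial>lebesgue) d"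
    using a d by (simp add: epowr_mult epowr_epowr \<theta>(3)) (simp add: \<theta>_def)
  finally show ?thesis
    using a d False by (simp add: Lnorm_rec_def)
qed

lemma Lnorm_rec_le_power:
  assumes a: "0 \<le> a" and [measurable]: "f \<in> borel_measurable lebesgue" "h \<in> borel_measurable lebesgue"
    and f: "AE x in lebesgue. f x \<le> M * epowr (h x) a"
  shows "Lnorm_rec a f \<le> M * epowr (\<integral>\<^sup>+x. h x \<partial>lebesgue) a"
proof (cases "a = 0")
  case True
  then have "esssup lebesgue f \<le> M" using f by (intro esssup_I) auto
  then show ?thesis using True by (simp add: Lnorm_rec_def)
next
  case False
  have "Lnorm_rec a f \<le> Lnorm_rec a (\<lambda>x. M * epowr (h x) a)"
    by (rule Lnorm_rec_mono_AE[OF a _ f]) measurable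
  also have "\<dots> = M * epowr (\<integral>\<^sup>+x. h x \<partial>lebesgue) a"
    using a False by (simp add: Lnorm_rec_def epowr_mult epowr_epowr nn_integral_cmult)
  finally show ?thesis .
qed

lemma nn_integral_normalize:
  assumes "J \<in> borel_measurable M" "0 < (\<integral>\<^sup>+x. J x \<partial>M)" "(\<integral>\<^sup>+x. J x \<partial>M) < top"
  shows "(\<integral>\<^sup>+x. J x / (\<integral>\<^sup>+x. J x \<partial>M) \<partial>M) = 1"
  using assms by (simp add: nn_integral_divide)

lemma Lnorm_rec_duality:
  fixes f :: "real^'n \<Rightarrow> ennreal"
  assumes a: "0 \<le> a" and d: "0 < d" and [measurable]: "f \<in> borel_measurable lebesgue"
    and c: "\<And>H. H \<in> borel_measurable lebesgue \<Longrightarrow> (\<integral>\<^sup>+x. H x \<partial>lebesgue) \<le> 1 \<Longrightarrow>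
        Lnorm_rec (a + d) (\<lambda>x. f x * epowr (H x) d) \<le> c"
  shows "Lnorm_rec a f \<le> c"
proof -
  obtain G :: "real^'n \<Rightarrow> ennreal" where [measurable]: "G \<in> borel_measurable lebesgue" and G: "\<forall>x. 0 < G x \<and> G x < top"
     "0 < (\<integral>\<^sup>+x. G x \<partial>lebesgue)" "(\<integral>\<^sup>+x. G x \<partial>lebesgue) < top"
    using ex_positive_integrable by blast
  show ?thesis
  proof (cases "a = 0")
    case True
    have "m \<le> c" if m: "m < esssup lebesgue f" for m
    proof -
      define J where "J x = G x * indicator {x. m < f x} x" for x
      have [measurable]: "J \<in> borel_measurable lebesgue" unfolding J_def by measurable
      define j where "j = (\<integral>\<^sup>+x. J x \<partial>lebesgue)"
      have "j \<le> (\<integral>\<^sup>+x. G x \<partial>lebesgue)"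
        unfolding j_def J_def by (intro nn_integral_mono) (auto simp: indicator_def)
      then have j_fin: "j < top" using G by (simp add: order_le_less_trans)
      have j_pos: "0 < j"
      proof (rule ccontr)
        assume "\<not> 0 < j"
        then have "AE x in lebesgue. J x = 0"
          unfolding j_def by (subst nn_integral_0_iff_AE[symmetric]) auto
        moreover have "f x \<le> m" if "J x = 0" for x
          using that G(1)[rule_format, of x] by (auto simp: J_def indicator_def not_less split: if_splits)
        ultimately have "AE x in lebesgue. f x \<le> m"
          by (auto elim: eventually_mono)
        then have "esssup lebesgue f \<le> m" by (intro esssup_I) auto
        then show False using m by simp
      qed
      define H where "H x = J x / j" for x
      have [measurable]: "H \<in> borel_measurable lebesgue" unfolding H_def by measurable
      have H1: "(\<integral>\<^sup>+x. H x \<partial>lebesgue) = 1"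
        unfolding H_def j_def using j_pos j_fin by (intro nn_integral_normalize) (auto simp: j_def)
      have "epowr m (1 / d) = (\<integral>\<^sup>+x. epowr m (1 / d) * H x \<partial>lebesgue)"
        by (simp add: nn_integral_cmult H1)
      also have "\<dots> \<le> (\<integral>\<^sup>+x. epowr (f x * epowr (H x) d) (1 / d) \<partial>lebesgue)"
      proof (intro nn_integral_mono)
        fix x
        show "epowr m (1 / d) * H x \<le> epowr (f x * epowr (H x) d) (1 / d)"
        proof (cases "m < f x")
          case True
          then show ?thesis using d by (auto simp: epowr_mult epowr_epowr intro!: mult_right_mono epowr_mono)
        qed (simp add: H_def J_def)
      qed
      finally have "epowr (epowr m (1 / d)) d \<le> epowr (\<integral>\<^sup>+x. epowr (f x * epowr (H x) d) (1 / d) \<partial>lebesgue) d"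
        using d by (intro epowr_mono) auto
      also have "\<dots> \<le> c"
        using c[of H] d True by (simp add: Lnorm_rec_def H1)
      finally show ?thesis using d by (simp add: epowr_epowr)
    qed
    then have "esssup lebesgue f \<le> c" by (rule dense_le)
    then show ?thesis using True by (simp add: Lnorm_rec_def)
  next
    case False
    then have a: "0 < a" using a by simp
    \<comment> \<open>The truncations are integrable, so they can be normalised even when the norm of
      \<open>f\<close> is infinite.\<close>
    define J where "J n x = min (epowr (f x) (1 / a)) (of_nat n * G x)" for n :: nat and x
    have [measurable]: "J n \<in> borel_measurable lebesgue" for n unfolding J_def by measurable
    have J_bound: "(\<integral>\<^sup>+x. J n x \<partial>lebesgue) \<le> epowr c (1 / a)" for n
    proof -
      define j where "j = (\<integral>\<^sup>+x. J n x \<partial>lebesgue)"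
      have "j \<le> (\<integral>\<^sup>+x. of_nat n * G x \<partial>lebesgue)"
        unfolding j_def J_def by (intro nn_integral_mono) auto
      also have "\<dots> = of_nat n * (\<integral>\<^sup>+x. G x \<partial>lebesgue)" by (simp add: nn_integral_cmult)
      also have "\<dots> < top" using G by (simp add: ennreal_mult_less_top of_nat_less_top)
      finally have j_fin: "j < top" .
      show ?thesis
      proof (cases "j = 0")
        case False
        then have j_pos: "0 < j" by (simp add: zero_less_iff_neq_zero)
        define H where "H x = J n x / j" for x
        have [measurable]: "H \<in> borel_measurable lebesgue" unfolding H_def by measurable
        have H1: "(\<integral>\<^sup>+x. H x \<partial>lebesgue) = 1"
          unfolding H_def j_def using j_pos j_fin by (intro nn_integral_normalize) (auto simp: j_def)
        define e where "e = d / (a + d)"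
        have e: "0 \<le> e" "a / (a + d) = 1 - e" "0 \<le> 1 - e" using a d by (auto simp: e_def field_simps)
        have "epowr j (1 - e) = inverse (epowr j e) * j"
          using epowr_add[OF j_pos j_fin, of "- e" 1] by (simp add: inverse_epowr)
        also have "\<dots> = (\<integral>\<^sup>+x. inverse (epowr j e) * J n x \<partial>lebesgue)"
          by (simp add: nn_integral_cmult j_def)
        also have "\<dots> \<le> (\<integral>\<^sup>+x. epowr (f x * epowr (H x) d) (1 / (a + d)) \<partial>lebesgue)"
        proof (intro nn_integral_mono)
          fix x
          have "epowr (J n x) (1 - e) \<le> epowr (epowr (f x) (1 / a)) (1 - e)"
            using e by (intro epowr_mono) (auto simp: J_def)
          also have "\<dots> = epowr (f x) (1 / (a + d))"
            unfolding epowr_epowr e(2)[symmetric] using a by simp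
          finally have Jf: "epowr (J n x) (1 - e) \<le> epowr (f x) (1 / (a + d))" .
          have "inverse (epowr j e) * J n x = epowr (J n x) (1 - e) * (epowr (J n x) e * inverse (epowr j e))"
            using epowr_add_nonneg[of "1 - e" e "J n x"] e by (simp add: mult_ac)
          also have "\<dots> = epowr (J n x) (1 - e) * epowr (H x) e"
            using e by (simp add: H_def epowr_divide divide_ennreal_def epowr_mult epowr_inverse inverse_epowr)
          also have "\<dots> \<le> epowr (f x) (1 / (a + d)) * epowr (H x) e"
            by (intro mult_right_mono Jf) simp
          also have "\<dots> = epowr (f x * epowr (H x) d) (1 / (a + d))"
            using a d by (simp add: epowr_mult epowr_epowr e_def)
          finally show "inverse (epowr j e) * J n x \<le> epowr (f x * epowr (H x) d) (1 / (a + d))" .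
        qed
        finally have "epowr (epowr j (1 - e)) (a + d)
            \<le> epowr (\<integral>\<^sup>+x. epowr (f x * epowr (H x) d) (1 / (a + d)) \<partial>lebesgue) (a + d)"
          using a d by (intro epowr_mono) auto
        also have "\<dots> \<le> c"
          using c[of H] a d by (simp add: Lnorm_rec_def H1)
        also have "epowr (epowr j (1 - e)) (a + d) = epowr j a"
          unfolding epowr_epowr e(2)[symmetric] using a d by simp
        finally show ?thesis using a by (simp add: epowr_le_iff j_def)
      qed (simp add: j_def)
    qed
    have "(\<integral>\<^sup>+x. epowr (f x) (1 / a) \<partial>lebesgue) = (\<integral>\<^sup>+x. (SUP n. J n x) \<partial>lebesgue)"
    proof (intro nn_integral_cong)
      fix x
      have "(SUP n. J n x) = inf (epowr (f x) (1 / a)) (SUP n. of_nat n * G x)"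
        unfolding J_def inf_min[symmetric] by (rule inf_SUP[symmetric])
      also have "(SUP n. of_nat n * G x) = (SUP n. of_nat n) * G x"
        by (rule SUP_mult_right_ennreal[symmetric])
      also have "\<dots> = top"
        using G(1) by (simp add: ennreal_SUP_of_nat_eq_top ennreal_top_mult zero_less_iff_neq_zero)
      finally show "epowr (f x) (1 / a) = (SUP n. J n x)" by simp
    qed
    also have "\<dots> = (SUP n. (\<integral>\<^sup>+x. J n x \<partial>lebesgue))"
    proof (rule nn_integral_monotone_convergence_SUP)
      show "incseq J"
        unfolding incseq_def le_fun_def J_def
        by (intro allI impI min.mono mult_right_mono order_refl) auto
    qed measurable
    also have "\<dots> \<le> epowr c (1 / a)" by (intro SUP_least J_bound)
    finally show ?thesis using a by (simp add: Lnorm_rec_def epowr_le_iff)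
  qed
qed

lemma extrapolation_down:
  fixes F :: "((real^'n \<Rightarrow> ennreal) \<times> (real^'n \<Rightarrow> ennreal)) set" and \<phi> :: "real \<Rightarrow> real"
  assumes meas: "\<And>f g. (f, g) \<in> F \<Longrightarrow> f \<in> borel_measurable lebesgue \<and> g \<in> borel_measurable lebesgue"
    and \<phi>: "mono_on {0..} \<phi>" "\<And>t. 0 \<le> t \<Longrightarrow> 0 \<le> \<phi> t"
    and hyp: "\<And>w f g. weight w \<Longrightarrow> A_rec \<alpha>0 (\<beta> + d) w < top \<Longrightarrow> (f, g) \<in> F \<Longrightarrow>
       Lnorm_rec c0 (\<lambda>x. f x * w x) \<le> ennreal (\<phi> (enn2real (A_rec \<alpha>0 (\<beta> + d) w))) * Lnorm_rec b0 (\<lambda>x. g x * w x)"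
    and pos: "0 \<le> \<alpha>0" "0 < \<beta>" "0 < d" "0 \<le> b0" "0 \<le> c0" and K: "0 < K"
  shows "\<exists>C\<ge>0. \<forall>w. weight w \<longrightarrow> A_rec (\<alpha>0 + d) \<beta> w \<le> ennreal K \<longrightarrow> (\<forall>(f, g) \<in> F.
      Lnorm_rec (c0 + d) (\<lambda>x. f x * w x) \<le> ennreal C * Lnorm_rec (b0 + d) (\<lambda>x. g x * w x))"
proof -
  obtain C :: real where C: "0 < C" and ex: "\<forall>w H :: real^'n \<Rightarrow> ennreal. weight w \<longrightarrow> A_rec (\<alpha>0 + d) \<beta> w \<le> ennreal K \<longrightarrow>
      H \<in> borel_measurable lebesgue \<longrightarrow> (\<integral>\<^sup>+x. H x \<partial>lebesgue) \<le> 1 \<longrightarrow>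
      (\<exists>h. weight h \<and> (AE x in lebesgue. H x \<le> h x) \<and> (\<integral>\<^sup>+x. h x \<partial>lebesgue) \<le> ennreal C \<and>
         A_rec \<alpha>0 (\<beta> + d) (\<lambda>x. w x * epowr (h x) (- d)) \<le> ennreal C)"
    using extrapolation_weight[of "\<alpha>0 + d" \<beta> \<alpha>0 d K] pos K by auto
  define C' where "C' = \<phi> C * C powr b0 * C powr d + 1"
  have \<phi>C: "0 \<le> \<phi> C" using \<phi>(2) C by simp
  have C': "0 < C'" using \<phi>C by (simp add: C'_def add_nonneg_pos)
  show ?thesis
  proof (intro exI[of _ C'] conjI allI impI ballI, goal_cases)
    case 1
    show ?case using C' by simp
  next
    case (2 w fg)
    obtain f g where fg: "fg = (f, g)" by (cases fg)
    have [measurable]: "f \<in> borel_measurable lebesgue" "g \<in> borel_measurable lebesgue"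
      using meas 2 fg by auto
    note [measurable] = weight_measurable[OF 2(1)]
    define N where "N = Lnorm_rec (b0 + d) (\<lambda>x. g x * w x)"
    define J where "J x = epowr (g x * w x) (1 / (b0 + d))" for x
    have [measurable]: "J \<in> borel_measurable lebesgue" unfolding J_def by measurable
    have N: "N = epowr (\<integral>\<^sup>+x. J x \<partial>lebesgue) (b0 + d)"
      using pos by (simp add: N_def J_def Lnorm_rec_def)
    have JJ: "g x * w x = epowr (J x) (b0 + d)" for x
      using pos by (simp add: J_def epowr_epowr)
    have "Lnorm_rec (c0 + d) (\<lambda>x. f x * w x) \<le> ennreal C' * N"
    proof (cases "N = top")
      case True
      then show ?thesis using C' by (simp add: ennreal_mult_top)
    next
      case N_fin: False
      define j where "j = (\<integral>\<^sup>+x. J x \<partial>lebesgue)"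
      have j_fin: "j < top"
        using N_fin pos unfolding N j_def[symmetric] by (simp add: less_top epowr_less_top_iff)
      obtain H where [measurable]: "H \<in> borel_measurable lebesgue" and H1: "(\<integral>\<^sup>+x. H x \<partial>lebesgue) \<le> 1"
        and HJ: "AE x in lebesgue. J x \<le> j * H x"
      proof (cases "j = 0")
        case True
        then have "AE x in lebesgue. J x = 0"
          by (subst nn_integral_0_iff_AE[symmetric]) (auto simp: j_def)
        then have "AE x in lebesgue. J x \<le> j * 0" by (rule eventually_mono) simp
        then show ?thesis by (intro that[of "\<lambda>_. 0"]) auto
      next
        case False
        then show ?thesis
          using j_fin nn_integral_normalize[of J lebesgue]
          by (intro that[of "\<lambda>x. J x / j"])
            (auto simp: j_def[symmetric] ennreal_times_divide mult.commute[of j] ennreal_mult_divide_eq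
                zero_less_iff_neq_zero)
      qed
      obtain h where h: "weight h" "AE x in lebesgue. H x \<le> h x" "(\<integral>\<^sup>+x. h x \<partial>lebesgue) \<le> ennreal C"
         "A_rec \<alpha>0 (\<beta> + d) (\<lambda>x. w x * epowr (h x) (- d)) \<le> ennreal C"
        using ex[rule_format, OF 2(1,2) _ H1] by auto
      note [measurable] = weight_measurable[OF h(1)]
      define W where "W x = w x * epowr (h x) (- d)" for x
      have W: "weight W" unfolding W_def by (intro weight_mult weight_epowr h 2)
      note [measurable] = weight_measurable[OF W]
      have AW: "A_rec \<alpha>0 (\<beta> + d) W \<le> ennreal C" using h(4) unfolding W_def .
      have hd: "AE x in lebesgue. epowr (h x) (- d) * epowr (h x) d = 1"
        using weight_AE[OF h(1)] by (rule eventually_mono) (use epowr_add[of _ "- d" d] in auto)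
      have "Lnorm_rec (c0 + d) (\<lambda>x. f x * w x) \<le> Lnorm_rec (c0 + d) (\<lambda>x. (f x * W x) * epowr (h x) d)"
      proof (rule Lnorm_rec_mono_AE)
        show "AE x in lebesgue. f x * w x \<le> f x * W x * epowr (h x) d"
          using hd
        proof eventually_elim
          case (elim x)
          have "f x * W x * epowr (h x) d = f x * w x * (epowr (h x) (- d) * epowr (h x) d)"
            by (simp add: W_def mult_ac)
          then show ?case using elim by simp
        qed
      qed (use pos in auto)
      also have "\<dots> \<le> Lnorm_rec c0 (\<lambda>x. f x * W x) * epowr (\<integral>\<^sup>+x. h x \<partial>lebesgue) d"
        using pos by (intro Lnorm_rec_Holder) auto
      also have "\<dots> \<le> (ennreal (\<phi> C) * (N * ennreal (C powr b0))) * ennreal (C powr d)"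
      proof (rule mult_mono)
        show "epowr (\<integral>\<^sup>+x. h x \<partial>lebesgue) d \<le> ennreal (C powr d)"
          using epowr_mono[OF _ h(3), of d] pos C by (simp add: epowr_ennreal)
        have fin: "A_rec \<alpha>0 (\<beta> + d) W < top" using AW by (simp add: order_le_less_trans)
        have "enn2real (A_rec \<alpha>0 (\<beta> + d) W) \<le> C"
          using AW C by (intro enn2real_leI) auto
        then have \<phi>W: "\<phi> (enn2real (A_rec \<alpha>0 (\<beta> + d) W)) \<le> \<phi> C"
          using C by (intro mono_onD[OF \<phi>(1)]) auto
        have "Lnorm_rec c0 (\<lambda>x. f x * W x) \<le> ennreal (\<phi> (enn2real (A_rec \<alpha>0 (\<beta> + d) W))) * Lnorm_rec b0 (\<lambda>x. g x * W x)"
          using hyp[OF W fin, of f g] 2 fg by simp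
        also have "\<dots> \<le> ennreal (\<phi> C) * (N * ennreal (C powr b0))"
        proof (intro mult_mono ennreal_leI \<phi>W)
          have "Lnorm_rec b0 (\<lambda>x. g x * W x) \<le> N * epowr (\<integral>\<^sup>+x. h x \<partial>lebesgue) b0"
          proof (rule Lnorm_rec_le_power)
            show "AE x in lebesgue. g x * W x \<le> N * epowr (h x) b0"
              using HJ h(2) weight_AE[OF h(1)]
            proof eventually_elim
              case (elim x)
              have "J x \<le> j * h x" using elim by (meson mult_left_mono order_trans zero_le)
              then have "g x * w x \<le> epowr (j * h x) (b0 + d)"
                unfolding JJ using pos by (intro epowr_mono) auto
              also have "\<dots> = N * epowr (h x) (b0 + d)"
                using pos by (simp add: epowr_mult N j_def)
              finally have "g x * w x * epowr (h x) (- d) \<le> N * epowr (h x) (b0 + d) * epowr (h x) (- d)"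
                by (rule mult_right_mono) simp
              also have "\<dots> = N * epowr (h x) b0"
                using epowr_add[of "h x" "b0 + d" "- d"] elim by (simp add: mult.assoc)
              finally show ?case by (simp add: W_def mult.assoc)
            qed
          qed (use pos in auto)
          also have "\<dots> \<le> N * ennreal (C powr b0)"
            using epowr_mono[OF _ h(3), of b0] pos C by (intro mult_left_mono) (auto simp: epowr_ennreal)
          finally show "Lnorm_rec b0 (\<lambda>x. g x * W x) \<le> N * ennreal (C powr b0)" .
        qed auto
        finally show "Lnorm_rec c0 (\<lambda>x. f x * W x) \<le> ennreal (\<phi> C) * (N * ennreal (C powr b0))" .
      qed auto
      also have "\<dots> = ennreal (\<phi> C * C powr b0 * C powr d) * N"
        using \<phi>C by (simp add: ennreal_mult mult_ac)
      also have "\<dots> \<le> ennreal C' * N"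
        by (intro mult_right_mono ennreal_leI) (auto simp: C'_def)
      finally show ?thesis .
    qed
    then show ?case by (simp add: fg N_def)
  qed
qed

lemma extrapolation_up:
  fixes F :: "((real^'n \<Rightarrow> ennreal) \<times> (real^'n \<Rightarrow> ennreal)) set" and \<phi> :: "real \<Rightarrow> real"
  assumes meas: "\<And>f g. (f, g) \<in> F \<Longrightarrow> f \<in> borel_measurable lebesgue \<and> g \<in> borel_measurable lebesgue"
    and \<phi>: "mono_on {0..} \<phi>" "\<And>t. 0 \<le> t \<Longrightarrow> 0 \<le> \<phi> t"
    and hyp: "\<And>w f g. weight w \<Longrightarrow> A_rec (\<alpha> + d) \<beta>0 w < top \<Longrightarrow> (f, g) \<in> F \<Longrightarrow>
       Lnorm_rec (c + d) (\<lambda>x. f x * w x) \<le> ennreal (\<phi> (enn2real (A_rec (\<alpha> + d) \<beta>0 w))) * Lnorm_rec (b + d) (\<lambda>x. g x * w x)"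
    and pos: "0 < \<alpha>" "0 \<le> \<beta>0" "0 < d" "0 \<le> b" "0 \<le> c" and K: "0 < K"
  shows "\<exists>C\<ge>0. \<forall>w. weight w \<longrightarrow> A_rec \<alpha> (\<beta>0 + d) w \<le> ennreal K \<longrightarrow> (\<forall>(f, g) \<in> F.
      Lnorm_rec c (\<lambda>x. f x * w x) \<le> ennreal C * Lnorm_rec b (\<lambda>x. g x * w x))"
proof -
  obtain C :: real where C: "0 < C" and ex: "\<forall>w H :: real^'n \<Rightarrow> ennreal. weight w \<longrightarrow> A_rec (\<beta>0 + d) \<alpha> w \<le> ennreal K \<longrightarrow>
      H \<in> borel_measurable lebesgue \<longrightarrow> (\<integral>\<^sup>+x. H x \<partial>lebesgue) \<le> 1 \<longrightarrow>
      (\<exists>h. weight h \<and> (AE x in lebesgue. H x \<le> h x) \<and> (\<integral>\<^sup>+x. h x \<partial>lebesgue) \<le> ennreal C \<and>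
         A_rec \<beta>0 (\<alpha> + d) (\<lambda>x. w x * epowr (h x) (- d)) \<le> ennreal C)"
    using extrapolation_weight[of "\<beta>0 + d" \<alpha> \<beta>0 d K] pos K by auto
  have \<phi>C: "0 \<le> \<phi> C" using \<phi>(2) C by simp
  show ?thesis
  proof (intro exI[of _ "\<phi> C * C powr d"] conjI allI impI ballI, goal_cases)
    case 1
    show ?case using \<phi>C by simp
  next
    case (2 w fg)
    obtain f g where fg: "fg = (f, g)" by (cases fg)
    have [measurable]: "f \<in> borel_measurable lebesgue" "g \<in> borel_measurable lebesgue"
      using meas 2 fg by auto
    note [measurable] = weight_measurable[OF 2(1)]
    define N where "N = Lnorm_rec b (\<lambda>x. g x * w x)"
    have "Lnorm_rec c (\<lambda>x. f x * w x) \<le> ennreal (\<phi> C) * (N * ennreal (C powr d))"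
    proof (rule Lnorm_rec_duality[OF \<open>0 \<le> c\<close> \<open>0 < d\<close>])
      fix H :: "real^'n \<Rightarrow> ennreal"
      assume [measurable]: "H \<in> borel_measurable lebesgue" and H1: "(\<integral>\<^sup>+x. H x \<partial>lebesgue) \<le> 1"
      have inv: "weight (\<lambda>x. inverse (w x))" by (rule weight_inverse[OF 2(1)])
      have invK: "A_rec (\<beta>0 + d) \<alpha> (\<lambda>x. inverse (w x)) \<le> ennreal K"
        using 2(2) by (simp add: A_rec_inverse)
      obtain h where h: "weight h" "AE x in lebesgue. H x \<le> h x" "(\<integral>\<^sup>+x. h x \<partial>lebesgue) \<le> ennreal C"
         "A_rec \<beta>0 (\<alpha> + d) (\<lambda>x. inverse (w x) * epowr (h x) (- d)) \<le> ennreal C"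
        using ex[rule_format, OF inv invK _ H1] by auto
      note [measurable] = weight_measurable[OF h(1)]
      define W where "W x = inverse (inverse (w x) * epowr (h x) (- d))" for x
      have W: "weight W" unfolding W_def by (intro weight_inverse weight_mult weight_epowr h 2 inv)
      note [measurable] = weight_measurable[OF W]
      have Weq: "AE x in lebesgue. W x = w x * epowr (h x) d"
        using weight_AE[OF 2(1)] weight_AE[OF h(1)]
      proof eventually_elim
        case (elim x)
        then have "inverse (w x) < top" by (auto simp: less_top[symmetric])
        moreover have "epowr (h x) (- d) < top"
          unfolding epowr_less_top_iff using elim pos by simp
        ultimately have "W x = inverse (inverse (w x)) * inverse (epowr (h x) (- d))"
          unfolding W_def by (rule ennreal_inverse_mult)
        then show ?case by (simp add: inverse_inverse_ennreal inverse_epowr)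
      qed
      have AW: "A_rec (\<alpha> + d) \<beta>0 W \<le> ennreal C"
        using h(4) unfolding W_def by (subst A_rec_inverse)
      have fin: "A_rec (\<alpha> + d) \<beta>0 W < top" using AW by (simp add: order_le_less_trans)
      have "enn2real (A_rec (\<alpha> + d) \<beta>0 W) \<le> C"
        using AW C by (intro enn2real_leI) auto
      then have \<phi>W: "\<phi> (enn2real (A_rec (\<alpha> + d) \<beta>0 W)) \<le> \<phi> C"
        using C by (intro mono_onD[OF \<phi>(1)]) auto
      have "Lnorm_rec (c + d) (\<lambda>x. f x * w x * epowr (H x) d) \<le> Lnorm_rec (c + d) (\<lambda>x. f x * W x)"
      proof (rule Lnorm_rec_mono_AE)
        show "AE x in lebesgue. f x * w x * epowr (H x) d \<le> f x * W x"
          using Weq h(2)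
        proof eventually_elim
          case (elim x)
          then show ?case
            unfolding elim(1) mult.assoc[of "f x"] using pos
            by (intro mult_left_mono epowr_mono) auto
        qed
      qed (use pos in auto)
      also have "\<dots> \<le> ennreal (\<phi> (enn2real (A_rec (\<alpha> + d) \<beta>0 W))) * Lnorm_rec (b + d) (\<lambda>x. g x * W x)"
        using hyp[OF W fin, of f g] 2 fg by simp
      also have "\<dots> \<le> ennreal (\<phi> C) * (N * ennreal (C powr d))"
      proof (intro mult_mono ennreal_leI \<phi>W)
        have "Lnorm_rec (b + d) (\<lambda>x. g x * W x) \<le> Lnorm_rec (b + d) (\<lambda>x. (g x * w x) * epowr (h x) d)"
        proof (rule Lnorm_rec_mono_AE)
          show "AE x in lebesgue. g x * W x \<le> g x * w x * epowr (h x) d"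
            using Weq by (rule eventually_mono) (simp add: mult.assoc)
        qed (use pos in auto)
        also have "\<dots> \<le> N * epowr (\<integral>\<^sup>+x. h x \<partial>lebesgue) d"
          unfolding N_def using pos by (intro Lnorm_rec_Holder) auto
        also have "\<dots> \<le> N * ennreal (C powr d)"
          using epowr_mono[OF _ h(3), of d] pos C by (intro mult_left_mono) (auto simp: epowr_ennreal)
        finally show "Lnorm_rec (b + d) (\<lambda>x. g x * W x) \<le> N * ennreal (C powr d)" .
      qed auto
      finally show "Lnorm_rec (c + d) (\<lambda>x. f x * w x * epowr (H x) d) \<le> ennreal (\<phi> C) * (N * ennreal (C powr d))" .
    qed measurable
    also have "\<dots> = ennreal (\<phi> C * C powr d) * N"
      using \<phi>C by (simp add: ennreal_mult mult_ac)
    finally show ?case by (simp add: fg N_def)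
  qed
qed

theorem theorem2p3:
  fixes F :: "(((real^'n) \<Rightarrow> ennreal) \<times> ((real^'n) \<Rightarrow> ennreal)) set"
    and p0 r0 q0 :: ereal
    and \<phi> :: "real \<Rightarrow> real"
  assumes "\<And>f g. (f, g) \<in> F \<Longrightarrow> f \<in> borel_measurable lebesgue \<and> g \<in> borel_measurable lebesgue"
    and "1 \<le> p0" and "0 < r0" and "0 < q0"
    and "mono_on {0..} \<phi>" and "\<And>t. 0 \<le> t \<Longrightarrow> 0 \<le> \<phi> t"
    and "\<And>w f g. w \<in> A_class p0 r0 \<Longrightarrow> (f, g) \<in> F \<Longrightarrow>
           Lnorm q0 (\<lambda>x. f x * w x)
             \<le> ennreal (\<phi> (enn2real (A_const p0 r0 w))) * Lnorm p0 (\<lambda>x. g x * w x)"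
  shows "\<forall>p r q :: ereal.
           1 < p \<and> 0 < r \<and> r < \<infinity> \<and> 0 < q \<and>
           1 / q - 1 / q0 = 1 / r - 1 / r0 \<and> 1 / r - 1 / r0 = 1 / p - 1 / p0 \<longrightarrow>
           (\<exists>\<psi> :: real \<Rightarrow> real. mono_on {0..} \<psi> \<and> (\<forall>t\<ge>0. 0 \<le> \<psi> t) \<and>
              (\<forall>w \<in> A_class p r. \<forall>(f, g) \<in> F.
                 Lnorm q (\<lambda>x. f x * w x)
                   \<le> ennreal (\<psi> (enn2real (A_const p r w))) * Lnorm p (\<lambda>x. g x * w x)))"
proof (intro allI impI, elim conjE)
  fix p r q :: ereal
  assume p: "1 < p" and r: "0 < r" "r < \<infinity>" and q: "0 < q"
    and eqs: "1 / q - 1 / q0 = 1 / r - 1 / r0" "1 / r - 1 / r0 = 1 / p - 1 / p0"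
  define \<alpha> \<alpha>0 b b0 c c0 where "\<alpha> = real_of_ereal (1 / r)" and "\<alpha>0 = real_of_ereal (1 / r0)"
    and "b = real_of_ereal (1 / p)" and "b0 = real_of_ereal (1 / p0)"
    and "c = real_of_ereal (1 / q)" and "c0 = real_of_ereal (1 / q0)"
  have recip: "1 / x = ereal (real_of_ereal (1 / x)) \<and> 0 \<le> real_of_ereal (1 / x)" if "0 < x" for x :: ereal
    using that by (cases x) (auto simp: one_ereal_def)
  have p_pos: "0 < p" "0 < p0"
    using p \<open>1 \<le> p0\<close> by (auto intro: less_trans less_le_trans[of 0 1])
  have ex: "1 / r = ereal \<alpha>" "1 / r0 = ereal \<alpha>0" "1 / p = ereal b" "1 / p0 = ereal b0"
      "1 / q = ereal c" "1 / q0 = ereal c0"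
    and nonneg: "0 \<le> \<alpha>0" "0 \<le> b" "0 \<le> b0" "0 \<le> c" "0 \<le> c0"
    using recip[of r] recip[of r0] recip[of p] recip[of p0] recip[of q] recip[of q0]
      p_pos r q \<open>0 < r0\<close> \<open>0 < q0\<close> by (auto simp: \<alpha>_def \<alpha>0_def b_def b0_def c_def c0_def)
  define d where "d = b - b0"
  have d: "c = c0 + d" "\<alpha> = \<alpha>0 + d" "b = b0 + d"
    using eqs unfolding ex by (auto simp: d_def)
  have \<alpha>_pos: "0 < \<alpha>" using r by (cases r) (auto simp: \<alpha>_def one_ereal_def)
  have b1: "b < 1" using p by (cases p) (auto simp: b_def one_ereal_def)
  have b01: "b0 \<le> 1" using \<open>1 \<le> p0\<close> by (cases p0) (auto simp: b0_def one_ereal_def)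
  have hyp: "Lnorm_rec c0 (\<lambda>x. f x * w x) \<le> ennreal (\<phi> (enn2real (A_rec \<alpha>0 (1 - b0) w))) * Lnorm_rec b0 (\<lambda>x. g x * w x)"
    if "weight w" "A_rec \<alpha>0 (1 - b0) w < top" "(f, g) \<in> F" for w f g
    using assms(7)[of w f g] that assms(2-4) p_pos
    by (simp add: A_class_def A_const_eq_rec Lnorm_eq_rec \<alpha>0_def b0_def c0_def)
  have bound: "\<exists>C\<ge>0. \<forall>w. weight w \<longrightarrow> A_rec \<alpha> (1 - b) w \<le> ennreal K \<longrightarrow> (\<forall>(f, g) \<in> F.
      Lnorm_rec c (\<lambda>x. f x * w x) \<le> ennreal C * Lnorm_rec b (\<lambda>x. g x * w x))" if K: "0 < K" for K
  proof -
    consider "d = 0" | "0 < d" | "d < 0" by linarith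
    then show ?thesis
    proof cases
      case 1
      show ?thesis
      proof (intro exI[of _ "\<phi> K"] conjI allI impI ballI, goal_cases)
        case 1
        then show ?case using assms(6) K by simp
      next
        case (2 w fg)
        have "A_rec \<alpha>0 (1 - b0) w \<le> ennreal K" using 2 \<open>d = 0\<close> d by simp
        then have fin: "A_rec \<alpha>0 (1 - b0) w < top" and "enn2real (A_rec \<alpha>0 (1 - b0) w) \<le> K"
          using K by (auto intro: order_le_less_trans enn2real_leI)
        then have "\<phi> (enn2real (A_rec \<alpha>0 (1 - b0) w)) \<le> \<phi> K"
          using K by (intro mono_onD[OF assms(5)]) auto
        then have "ennreal (\<phi> (enn2real (A_rec \<alpha>0 (1 - b0) w))) * X \<le> ennreal (\<phi> K) * X" for X
          by (intro mult_right_mono ennreal_leI) auto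
        then show ?case
          using hyp[OF 2(1) fin] 2(3) \<open>d = 0\<close> d by (auto intro: order_trans)
      qed
    next
      case 2
      have e: "\<alpha>0 + d = \<alpha>" "c0 + d = c" "b0 + d = b" "1 - b + d = 1 - b0" using d by auto
      show ?thesis
        using extrapolation_down[of F \<phi> \<alpha>0 "1 - b" d c0 b0 K, unfolded e] assms(1,5,6) hyp nonneg b1 2 K
        by simp
    next
      case 3
      have e: "\<alpha> + - d = \<alpha>0" "c + - d = c0" "b + - d = b0" "1 - b0 + - d = 1 - b" using d by auto
      show ?thesis
        using extrapolation_up[of F \<phi> \<alpha> "- d" "1 - b0" c b K, unfolded e] assms(1,5,6) hyp nonneg b01 \<alpha>_pos 3 K
        by simp
    qed
  qed
  have "\<forall>n. \<exists>C\<ge>0. \<forall>w. weight w \<longrightarrow> A_rec \<alpha> (1 - b) w \<le> ennreal (real (Suc n)) \<longrightarrow> (\<forall>(f, g) \<in> F.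
      Lnorm_rec c (\<lambda>x. f x * w x) \<le> ennreal C * Lnorm_rec b (\<lambda>x. g x * w x))"
    by (intro allI bound) simp
  from choice[OF this] obtain C where "\<forall>n. 0 \<le> C n \<and> (\<forall>w. weight w \<longrightarrow>
      A_rec \<alpha> (1 - b) w \<le> ennreal (real (Suc n)) \<longrightarrow> (\<forall>(f, g) \<in> F.
      Lnorm_rec c (\<lambda>x. f x * w x) \<le> ennreal (C n) * Lnorm_rec b (\<lambda>x. g x * w x)))"
    by (elim exE)
  then have C: "\<And>n. 0 \<le> C n" "\<And>n w f g. weight w \<Longrightarrow> A_rec \<alpha> (1 - b) w \<le> ennreal (real (Suc n)) \<Longrightarrow> (f, g) \<in> F \<Longrightarrow>
      Lnorm_rec c (\<lambda>x. f x * w x) \<le> ennreal (C n) * Lnorm_rec b (\<lambda>x. g x * w x)"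
    by (fastforce simp del: of_nat_Suc)+
  \<comment> \<open>The bounds obtained for the single values of the constant need not be monotone; their
    partial sums are.\<close>
  define \<psi> where "\<psi> t = (\<Sum>k\<le>nat \<lceil>t\<rceil>. C k)" for t :: real
  show "\<exists>\<psi> :: real \<Rightarrow> real. mono_on {0..} \<psi> \<and> (\<forall>t\<ge>0. 0 \<le> \<psi> t) \<and>
              (\<forall>w \<in> A_class p r. \<forall>(f, g) \<in> F.
                 Lnorm q (\<lambda>x. f x * w x)
                   \<le> ennreal (\<psi> (enn2real (A_const p r w))) * Lnorm p (\<lambda>x. g x * w x))"
  proof (intro exI[of _ \<psi>] conjI allI impI ballI)
    show "mono_on {0..} \<psi>"
    proof (rule mono_onI)
      fix s t :: real assume "s \<le> t"
      then have "nat \<lceil>s\<rceil> \<le> nat \<lceil>t\<rceil>" by (intro nat_mono ceiling_mono)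
      then show "\<psi> s \<le> \<psi> t" unfolding \<psi>_def using C(1) by (intro sum_mono2) auto
    qed
    show "0 \<le> \<psi> t" for t unfolding \<psi>_def by (intro sum_nonneg C)
    fix w :: "real^'n \<Rightarrow> ennreal" and fg assume w: "w \<in> A_class p r" and fg: "fg \<in> F"
    define A where "A = A_rec \<alpha> (1 - b) w"
    have A: "A_const p r w = A"
      using p r by (simp add: A_const_eq_rec A_def \<alpha>_def b_def)
    have wA: "weight w" "A < top" using w by (auto simp: A_class_def A)
    define t where "t = enn2real A"
    have "A = ennreal t" using wA by (simp add: t_def)
    also have "\<dots> \<le> ennreal (real (Suc (nat \<lceil>t\<rceil>)))"
      by (intro ennreal_leI) (use of_nat_ceiling[of t] in linarith)
    finally have "Lnorm_rec c (\<lambda>x. f x * w x) \<le> ennreal (C (nat \<lceil>t\<rceil>)) * Lnorm_rec b (\<lambda>x. g x * w x)"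
      if "(f, g) \<in> F" for f g
      using C(2)[OF wA(1) _ that] by (simp add: A_def)
    moreover have "C (nat \<lceil>t\<rceil>) \<le> \<psi> t"
      unfolding \<psi>_def using C(1) by (intro member_le_sum) auto
    then have "ennreal (C (nat \<lceil>t\<rceil>)) * X \<le> ennreal (\<psi> t) * X" for X
      by (intro mult_right_mono ennreal_leI) auto
    ultimately have "Lnorm_rec c (\<lambda>x. f x * w x) \<le> ennreal (\<psi> t) * Lnorm_rec b (\<lambda>x. g x * w x)"
      if "(f, g) \<in> F" for f g
      using that order_trans by blast
    then show "case fg of (f, g) \<Rightarrow> Lnorm q (\<lambda>x. f x * w x)
        \<le> ennreal (\<psi> (enn2real (A_const p r w))) * Lnorm p (\<lambda>x. g x * w x)"
      using fg p_pos q by (auto simp: A Lnorm_eq_rec t_def b_def c_def)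
  qed
qed

end
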